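(* For all integers $n\geq 0$, $$DSOME(15625n+651)\equiv 5\,DSOME(25n+1)+DSOME(625n+26)-5\,DSOME(n)\pmod{8},$$ and, for all integers $n\ge 0$ and all integers $r$ with $1\leq r\leq 4$, $$DSOME(15625n+3125r+651)\equiv 5\,DSOME(25n+5r+1)+DSOME(625n+125r+26)\pmod{8}.$$
   Context: For an integer $n\ge 0$, $DSOME(n)$ denotes the sum of all the odd parts in all the partitions of $n$ into distinct parts minus the sum of all the even parts in all the partitions of $n$ into distinct parts. That is, $DSOME(n)=\sum_{\lambda}\left(\sum_{\lambda_i \text{ odd}}\lambda_i-\sum_{\lambda_i\text{ even}}\lambda_i\right)$, where $\lambda$ runs over all partitions of $n$ into distinct parts and $\lambda_i$ runs over the parts of $\lambda$; in particular $DSOME(0)=0$. *)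

theory Defs
  imports "HOL-Number_Theory.Cong"
begin

text \<open>
  A partition into distinct parts has no repeated parts, so it is represented by the finite set
  of its parts.
\<close>

definition distinct_partitions :: "nat \<Rightarrow> nat set set" where
  "distinct_partitions n = {A. finite A \<and> (\<forall>k\<in>A. 0 < k) \<and> \<Sum>A = n}"

definition DSOME :: "nat \<Rightarrow> int" where
  "DSOME n = (\<Sum>A\<in>distinct_partitions n.
     (\<Sum>k | k \<in> A \<and> odd k. int k) - (\<Sum>k | k \<in> A \<and> even k. int k))"

text \<open>Finiteness ensures that the outer sum in the definition of \<open>DSOME\<close> is a genuine one.\<close>

lemma finite_distinct_partitions: "finite (distinct_partitions n)"
proof (rule finite_subset)
  show "distinct_partitions n \<subseteq> Pow {..n}"
    by (auto simp: distinct_partitions_def intro: member_le_sum[where f = "\<lambda>x. x"])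
qed simp

lemma DSOME_0: "DSOME 0 = 0"
proof -
  have "distinct_partitions 0 = {{}}"
    by (fastforce simp: distinct_partitions_def)
  then show ?thesis
    by (simp add: DSOME_def)
qed

end

theory Submission
  imports Defs "HOL-Computational_Algebra.Formal_Power_Series"
begin

text \<open>
  Write \<open>E = (q; q)\<^sub>\<infinity>\<close>, \<open>\<theta> = \<Sum>(-1)\<^sup>x q\<^bsup>x\<^sup>2\<^esup>\<close>, \<open>\<theta>\<^sub>+ = \<theta>(-q)\<close> and
  \<open>T = \<Sum>(6 t + 1) q\<^bsup>t(3t+1)/2\<^esup>\<close> (\<open>qpoch (-1) 1 1\<close>, \<open>theta\<close>, \<open>theta_pos\<close>, \<open>lin_theta\<close> below).  The generating function of \<open>DSOME\<close> is
  \<open>F d/d(log q) (log (F\<^sub>1 / F\<^sub>2))\<close>, where \<open>F = F\<^sub>1 F\<^sub>2\<close> splits distinct parts into odd and even ones.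
  The argument of Jacobi's four-square theorem turns it into \<open>(E / \<theta> - E \<theta>\<^sup>3) / 8\<close>.
  Since \<open>\<theta> \<equiv> 1 (mod 2)\<close> and \<open>T = E \<theta>\<^sup>2\<close>, modulo 8 this becomes a combination, divided by 4, of the series
  \<open>E\<close>, \<open>T\<close>, \<open>T(-q)\<close>, \<open>E \<theta>\<close>, \<open>T \<theta>\<close>, \<open>T \<theta>\<^sub>+\<close>.  Each of these is a unary theta series or a binary one
  for the form \<open>n\<^sup>2 + 24 x\<^sup>2 = 24 N + 1\<close>, i.e. the norm form of \<open>\<int>[\<surd>-6]\<close>.  As \<open>25 = (1 + 2\<surd>-6)(1 - 2\<surd>-6)\<close>,
  multiplying the index \<open>24 N + 1\<close> by 25 acts on each of them by an explicit recurrence of order at most two,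
  and the operator \<open>X\<^sup>3 - X\<^sup>2 - 5 X + 5\<close> annihilates the combination modulo 32.
\<close>

unbundle fps_syntax

section \<open>Infinite products of formal power series\<close>

text \<open>The constants come from the index: \<open>N -> 25 N + 1\<close> multiplies
  \<open>24 N + 1\<close> by 25, and its iterates are \<open>625 N + 26\<close> and
  \<open>15625 N + 651\<close>. The step is 25 and not 5 because 5 splits in Q(sqrt(-6)) into two
  nonprincipal primes, and only their squares are principal, generated by 1 + 2 sqrt(-6) and 1 - 2
  sqrt(-6). The operator is (X - 1)(X^2 - 5). It does not annihilate each series modulo 32: modulo
  its own recurrence it leaves 8 on \<open>E theta\<close> and -24 X + 80 on \<open>T theta\<close>.
  Only the weighted sum of these remainders is divisible by 32, because the binary series agree
  modulo 4 and \<open>T\<close>, \<open>E\<close> modulo 2. The obstacle is the denominator of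
  \<open>E / theta\<close>. Inverting theta = 1 + 2 S modulo 8 leaves a term of degree 4 in S
  outside the unary and binary series. It is absorbed through S^2 = S(q^2) mod 2, and this is what
  brings in \<open>T(-q)\<close> and the unsigned theta series. For 1 <= r <= 4 the smallest index
  is divisible by 5 exactly once. It has no predecessor, so the term in \<open>DSOME n\<close>
  disappears.\<close>

lemma tendsto_mult_fps:
  fixes P Q :: "nat \<Rightarrow> int fps"
  assumes "P \<longlonglongrightarrow> p" "Q \<longlonglongrightarrow> q"
  shows "(\<lambda>n. P n * Q n) \<longlonglongrightarrow> p * q"
proof (rule tendsto_fpsI)
  fix n
  have "eventually (\<lambda>m. \<forall>i\<in>{..n}. P m $ i = p $ i) sequentially"
    using assms(1) by (subst eventually_ball_finite_distrib) (auto simp: tendsto_fps_iff)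
  moreover have "eventually (\<lambda>m. \<forall>i\<in>{..n}. Q m $ i = q $ i) sequentially"
    using assms(2) by (subst eventually_ball_finite_distrib) (auto simp: tendsto_fps_iff)
  ultimately show "eventually (\<lambda>m. (P m * Q m) $ n = (p * q) $ n) sequentially"
    by eventually_elim (simp add: fps_mult_nth)
qed

lemma tendsto_mult_zero_fps:
  fixes P Q :: "nat \<Rightarrow> int fps"
  assumes "P \<longlonglongrightarrow> 0"
  shows "(\<lambda>n. P n * Q n) \<longlonglongrightarrow> 0"
proof (rule tendsto_fpsI)
  fix n
  have "eventually (\<lambda>m. \<forall>i\<in>{..n}. P m $ i = 0) sequentially"
    using assms(1) by (subst eventually_ball_finite_distrib) (auto simp: tendsto_fps_iff)
  then show "eventually (\<lambda>m. (P m * Q m) $ n = 0 $ n) sequentially"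
    by eventually_elim (simp add: fps_mult_nth)
qed

lemma tendsto_add_fps:
  fixes P Q :: "nat \<Rightarrow> int fps"
  assumes "P \<longlonglongrightarrow> p" "Q \<longlonglongrightarrow> q"
  shows "(\<lambda>n. P n + Q n) \<longlonglongrightarrow> p + q"
proof (rule tendsto_fpsI)
  fix n
  show "eventually (\<lambda>m. (P m + Q m) $ n = (p + q) $ n) sequentially"
    using assms[unfolded tendsto_fps_iff, rule_format, of n]
    by eventually_elim simp
qed

lemma tendsto_compose_fps:
  fixes P :: "nat \<Rightarrow> int fps"
  assumes "P \<longlonglongrightarrow> p"
  shows "(\<lambda>n. P n oo c) \<longlonglongrightarrow> (p oo c)"
proof (rule tendsto_fpsI)
  fix n
  have "eventually (\<lambda>m. \<forall>i\<in>{..n}. P m $ i = p $ i) sequentially"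
    using assms(1) by (subst eventually_ball_finite_distrib) (auto simp: tendsto_fps_iff)
  then show "eventually (\<lambda>m. (P m oo c) $ n = (p oo c) $ n) sequentially"
    by eventually_elim (simp add: fps_compose_nth)
qed

lemma fps_nth_compose_X_power:
  fixes f :: "int fps"
  assumes "k > 0"
  shows "(f oo fps_X ^ k) $ n = (if k dvd n then f $ (n div k) else 0)"
proof -
  have pow: "((fps_X :: int fps) ^ k) ^ i $ n = (if n = k * i then 1 else 0)" for i
    unfolding power_mult [symmetric] by (rule fps_X_power_nth)
  have "(f oo fps_X ^ k) $ n = (\<Sum>i\<in>{0..n}. if n = k * i then f $ i else 0)"
    unfolding fps_compose_nth pow by (rule sum.cong) simp_all
  also have "\<dots> = (\<Sum>i\<in>{0..n}. if i = n div k then (if k dvd n then f $ i else 0) else 0)"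
    using assms by (intro sum.cong) auto
  also have "\<dots> = (if k dvd n then f $ (n div k) else 0)"
    by (subst sum.delta) auto
  finally show ?thesis .
qed

text \<open>\<open>qpoch s d r\<close> is \<open>(-s q\<^sup>r; q\<^sup>d)\<^sub>\<infinity>\<close>; note the sign.\<close>

definition qpoch_fin :: "int \<Rightarrow> nat \<Rightarrow> nat \<Rightarrow> nat \<Rightarrow> int fps" where
  "qpoch_fin s d r n = (\<Prod>i<n. 1 + fps_const s * fps_X ^ (d * i + r))"

definition qpoch :: "int \<Rightarrow> nat \<Rightarrow> nat \<Rightarrow> int fps" where
  "qpoch s d r = Abs_fps (\<lambda>k. qpoch_fin s d r k $ k)"

text \<open>Factor \<open>n\<close> has exponent \<open>d * n + r > n\<close>, so factors from index
  \<open>k\<close> on cannot touch coefficient \<open>k\<close>. This is what makes the diagonal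
  definition of \<open>qpoch\<close> the limit of the finite products.\<close>

lemma qpoch_fin_nth_stable:
  assumes "d > 0" "r > 0" "k \<le> n"
  shows "qpoch_fin s d r n $ k = qpoch_fin s d r k $ k"
  using assms(3)
proof (induction n rule: dec_induct)
  case (step n)
  have "n \<le> d * n" using assms(1) by simp
  then have "k < d * n + r"
    using step.hyps assms(2) by linarith
  moreover have "qpoch_fin s d r (Suc n) = qpoch_fin s d r n +
      fps_const s * (fps_X ^ (d * n + r) * qpoch_fin s d r n)"
    by (simp add: qpoch_fin_def algebra_simps)
  ultimately show ?case
    using step by (simp add: fps_X_power_mult_nth)
qed simp

lemma qpoch_tendsto:
  assumes "d > 0" "r > 0"
  shows "qpoch_fin s d r \<longlonglongrightarrow> qpoch s d r"
proof (rule tendsto_fpsI)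
  fix k
  show "eventually (\<lambda>n. qpoch_fin s d r n $ k = qpoch s d r $ k) sequentially"
    using eventually_ge_at_top[of k]
    by eventually_elim (unfold qpoch_def fps_nth_Abs_fps, rule qpoch_fin_nth_stable[OF assms])
qed

lemma qpoch_nth_0 [simp]: "qpoch s d r $ 0 = 1"
  by (simp add: qpoch_def qpoch_fin_def)

lemma qpoch_nonzero [simp]: "qpoch s d r \<noteq> 0"
  by (metis fps_zero_nth qpoch_nth_0 zero_neq_one)

lemma qpoch_fin_nth_0: "r > 0 \<Longrightarrow> qpoch_fin s d r n $ 0 = 1"
  by (induction n) (auto simp: qpoch_fin_def)

lemma qpoch_fin_nonzero: "r > 0 \<Longrightarrow> qpoch_fin s d r n \<noteq> 0"
  by (metis fps_zero_nth qpoch_fin_nth_0 zero_neq_one)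

lemma LIMSEQ_linear:
  assumes "X \<longlonglongrightarrow> (a::int fps)" "c > 0"
  shows "(\<lambda>n. X (c * n)) \<longlonglongrightarrow> a"
proof -
  have "strict_mono ((*) c)" using assms(2) by (intro strict_monoI) simp
  from LIMSEQ_subseq_LIMSEQ[OF assms(1) this] show ?thesis unfolding o_def .
qed

lemma qpoch_fin_compose:
  assumes "c $ 0 = 0"
  shows "(qpoch_fin s d r n oo c) = (\<Prod>i<n. 1 + fps_const s * c ^ (d * i + r))"
proof -
  have "((1 + fps_const s * fps_X ^ k) oo c) = 1 + fps_const s * c ^ k" for k
    unfolding fps_compose_add_distrib fps_compose_mult_distrib[OF assms] fps_compose_1
      fps_const_compose fps_X_power_compose[OF assms] ..
  then show ?thesis
    unfolding qpoch_fin_def fps_compose_prod_distrib[OF assms] by (simp only:)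
qed

lemma qpoch_compose:
  assumes "d > 0" "r > 0" "c > 0"
  shows "qpoch s d r oo fps_X ^ c = qpoch s (c * d) (c * r)"
proof (rule LIMSEQ_unique)
  show "(\<lambda>n. qpoch_fin s d r n oo fps_X ^ c) \<longlonglongrightarrow> (qpoch s d r oo fps_X ^ c)"
    by (intro tendsto_compose_fps qpoch_tendsto assms)
  have "(fps_X ^ c) ^ (d * i + r) = (fps_X :: int fps) ^ (c * d * i + c * r)" for i
    unfolding power_mult [symmetric] by (simp only: distrib_left mult.assoc)
  moreover have "((fps_X :: int fps) ^ c) $ 0 = 0"
    using assms(3) by (simp add: fps_X_power_nth)
  ultimately have *: "(qpoch_fin s d r n oo fps_X ^ c) = qpoch_fin s (c * d) (c * r) n" for n
    by (simp only: qpoch_fin_compose) (simp only: qpoch_fin_def)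
  show "(\<lambda>n. qpoch_fin s d r n oo fps_X ^ c) \<longlonglongrightarrow> qpoch s (c * d) (c * r)"
    unfolding * by (rule qpoch_tendsto) (use assms in simp_all)
qed

lemma qpoch_fin_0 [simp]: "qpoch_fin s d r 0 = 1"
  by (simp add: qpoch_fin_def)

lemma qpoch_fin_Suc:
  "qpoch_fin s d r (Suc n) = qpoch_fin s d r n * (1 + fps_const s * fps_X ^ (d * n + r))"
  by (simp add: qpoch_fin_def)

lemma qpoch_fin_split_2:
  "qpoch_fin s d r (2 * n) = qpoch_fin s (2 * d) r n * qpoch_fin s (2 * d) (d + r) n"
proof (induction n)
  case (Suc n)
  have e: "2 * Suc n = Suc (Suc (2 * n))" "d * (2 * n) + r = 2 * d * n + r"
    "d * Suc (2 * n) + r = 2 * d * n + (d + r)" by simp_all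
  show ?case unfolding e qpoch_fin_Suc Suc by (simp only: ac_simps)
qed simp

lemma qpoch_split_2:
  assumes "d > 0" "r > 0"
  shows "qpoch s d r = qpoch s (2 * d) r * qpoch s (2 * d) (d + r)"
proof (rule LIMSEQ_unique)
  show "(\<lambda>n. qpoch_fin s d r (2 * n)) \<longlonglongrightarrow> qpoch s d r"
    by (intro LIMSEQ_linear qpoch_tendsto assms) simp
  show "(\<lambda>n. qpoch_fin s d r (2 * n)) \<longlonglongrightarrow> qpoch s (2 * d) r * qpoch s (2 * d) (d + r)"
    unfolding qpoch_fin_split_2 using assms by (intro tendsto_mult_fps qpoch_tendsto) auto
qed

lemma qpoch_fin_split_3: "qpoch_fin s d r (3 * n) =
  qpoch_fin s (3 * d) r n * qpoch_fin s (3 * d) (d + r) n * qpoch_fin s (3 * d) (2 * d + r) n"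
proof (induction n)
  case (Suc n)
  have e: "3 * Suc n = Suc (Suc (Suc (3 * n)))" "d * (3 * n) + r = 3 * d * n + r"
    "d * Suc (3 * n) + r = 3 * d * n + (d + r)"
    "d * Suc (Suc (3 * n)) + r = 3 * d * n + (2 * d + r)" by simp_all
  show ?case unfolding e qpoch_fin_Suc Suc by (simp only: ac_simps)
qed simp

lemma qpoch_split_3:
  assumes "d > 0" "r > 0"
  shows "qpoch s d r = qpoch s (3 * d) r * qpoch s (3 * d) (d + r) * qpoch s (3 * d) (2 * d + r)"
proof (rule LIMSEQ_unique)
  show "(\<lambda>n. qpoch_fin s d r (3 * n)) \<longlonglongrightarrow> qpoch s d r"
    by (intro LIMSEQ_linear qpoch_tendsto assms) simp
  show "(\<lambda>n. qpoch_fin s d r (3 * n)) \<longlonglongrightarrow>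
      qpoch s (3 * d) r * qpoch s (3 * d) (d + r) * qpoch s (3 * d) (2 * d + r)"
    unfolding qpoch_fin_split_3 using assms by (intro tendsto_mult_fps qpoch_tendsto) auto
qed

lemma qpoch_mult_minus:
  assumes "d > 0" "r > 0"
  shows "qpoch 1 d r * qpoch (-1) d r = qpoch (-1) (2 * d) (2 * r)"
proof (rule LIMSEQ_unique)
  show "(\<lambda>n. qpoch_fin 1 d r n * qpoch_fin (-1) d r n) \<longlonglongrightarrow> qpoch 1 d r * qpoch (-1) d r"
    by (intro tendsto_mult_fps qpoch_tendsto assms)
  have "(1 + fps_const 1 * fps_X ^ k) * (1 + fps_const (-1) * fps_X ^ k) =
      1 + fps_const (-1) * (fps_X :: int fps) ^ (2 * k)" for k
    by (simp add: algebra_simps mult_2_right power_add flip: fps_const_neg)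
  from this[of "d * i + r" for i]
  have *: "qpoch_fin 1 d r n * qpoch_fin (-1) d r n = qpoch_fin (-1) (2 * d) (2 * r) n" for n
    unfolding qpoch_fin_def prod.distrib [symmetric]
    by (simp only: distrib_left mult.assoc)
  show "(\<lambda>n. qpoch_fin 1 d r n * qpoch_fin (-1) d r n) \<longlonglongrightarrow> qpoch (-1) (2 * d) (2 * r)"
    unfolding * by (rule qpoch_tendsto) (use assms in simp_all)
qed

lemma qpoch_compose_uminus_odd:
  assumes "odd r"
  shows "qpoch s 2 r oo (- fps_X) = qpoch (-s) 2 r"
proof (rule LIMSEQ_unique)
  have "r > 0" using assms by (cases r) auto
  show "(\<lambda>n. qpoch_fin s 2 r n oo (-fps_X)) \<longlonglongrightarrow> (qpoch s 2 r oo (-fps_X))"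
    using \<open>r > 0\<close> by (intro tendsto_compose_fps qpoch_tendsto) auto
  have *: "(qpoch_fin s 2 r n oo (-fps_X)) = qpoch_fin (-s) 2 r n" for n
    by (subst qpoch_fin_compose)
      (use assms in \<open>simp_all add: qpoch_fin_def power_minus_odd flip: fps_const_neg\<close>)
  show "(\<lambda>n. qpoch_fin s 2 r n oo (-fps_X)) \<longlonglongrightarrow> qpoch (-s) 2 r"
    unfolding * by (rule qpoch_tendsto) (use \<open>r > 0\<close> in simp_all)
qed

lemma qpoch_compose_uminus_even:
  assumes "even r" "r > 0"
  shows "qpoch s 2 r oo (- fps_X) = qpoch s 2 r"
proof (rule LIMSEQ_unique)
  show "(\<lambda>n. qpoch_fin s 2 r n oo (-fps_X)) \<longlonglongrightarrow> (qpoch s 2 r oo (-fps_X))"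
    using \<open>r > 0\<close> by (intro tendsto_compose_fps qpoch_tendsto) auto
  have *: "(qpoch_fin s 2 r n oo (-fps_X)) = qpoch_fin s 2 r n" for n
    by (subst qpoch_fin_compose) (use assms in \<open>simp_all add: qpoch_fin_def\<close>)
  show "(\<lambda>n. qpoch_fin s 2 r n oo (-fps_X)) \<longlonglongrightarrow> qpoch s 2 r"
    unfolding * by (rule qpoch_tendsto) (use assms in simp_all)
qed

section \<open>Formal theta series\<close>

text \<open>Formal sums \<open>\<Sum>\<^sub>i w i q\<^bsup>e i\<^esup>\<close>; they only make sense if \<open>e\<close> is nonnegative with finite fibres.\<close>

definition gser :: "'i set \<Rightarrow> ('i \<Rightarrow> int) \<Rightarrow> ('i \<Rightarrow> int) \<Rightarrow> int fps" where
  "gser I w e = Abs_fps (\<lambda>N. \<Sum>i\<in>{i\<in>I. e i = int N}. w i)"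

text \<open>Finiteness is asked of sublevel sets, equivalent to finite fibres for nonnegative
  integer values, because a product of two series involves all pairs below a bound.\<close>

definition proper :: "'i set \<Rightarrow> ('i \<Rightarrow> int) \<Rightarrow> bool" where
  "proper I e \<longleftrightarrow> (\<forall>i\<in>I. 0 \<le> e i) \<and> (\<forall>N. finite {i\<in>I. e i \<le> N})"

lemma gser_nth: "gser I w e $ N = (\<Sum>i\<in>{i\<in>I. e i = int N}. w i)"
  by (simp add: gser_def)

lemma properD:
  assumes "proper I e"
  shows "i \<in> I \<Longrightarrow> 0 \<le> e i" "finite {i\<in>I. e i \<le> N}" "finite {i\<in>I. e i = N}"
  using assms rev_finite_subset[of "{i\<in>I. e i \<le> N}" "{i\<in>I. e i = N}"]
  by (auto simp: proper_def)

lemma proper_subset: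
  assumes "proper I e" "J \<subseteq> I"
  shows "proper J e"
  unfolding proper_def
proof (intro conjI allI)
  show "finite {i \<in> J. e i \<le> N}" for N
    by (rule finite_subset[OF _ properD(2)[OF assms(1), of N]]) (use assms(2) in auto)
qed (use assms in \<open>auto simp: proper_def\<close>)

text \<open>The slack of 1 accommodates triangular numbers: j (j + 1) / 2 vanishes at j =
  -1.\<close>

lemma properI_abs:
  fixes e :: "int \<Rightarrow> int"
  assumes "\<And>i. \<bar>i\<bar> - 1 \<le> e i" "\<And>i. 0 \<le> e i"
  shows "proper UNIV e"
  unfolding proper_def
proof (intro conjI allI)
  show "finite {i \<in> UNIV. e i \<le> N}" for N
  proof (rule finite_subset)
    show "{i \<in> UNIV. e i \<le> N} \<subseteq> {- (N + 1)..N + 1}"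
    proof
      fix i assume "i \<in> {i \<in> UNIV. e i \<le> N}"
      then have "\<bar>i\<bar> - 1 \<le> N" using assms(1)[of i] by simp
      then show "i \<in> {- (N + 1)..N + 1}" by auto
    qed
  qed simp
qed (use assms in auto)

lemma proper_times:
  assumes "proper I e" "proper J f"
  shows "proper (I \<times> J) (\<lambda>(i, j). e i + f j)"
  unfolding proper_def
proof (intro conjI allI ballI)
  show "0 \<le> (case x of (i, j) \<Rightarrow> e i + f j)" if "x \<in> I \<times> J" for x
    using that properD(1)[OF assms(1)] properD(1)[OF assms(2)] by fastforce
  show "finite {x \<in> I \<times> J. (case x of (i, j) \<Rightarrow> e i + f j) \<le> N}" for N
  proof (rule finite_subset)
    show "{x \<in> I \<times> J. (case x of (i, j) \<Rightarrow> e i + f j) \<le> N} \<subseteq> {i\<in>I. e i \<le> N} \<times> {j\<in>J. f j \<le> N}"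
      using properD(1)[OF assms(1)] properD(1)[OF assms(2)] by fastforce
    show "finite ({i\<in>I. e i \<le> N} \<times> {j\<in>J. f j \<le> N})"
      by (intro finite_cartesian_product properD assms)
  qed
qed

lemma gser_mult:
  assumes "proper I e" "proper J f"
  shows "gser I w e * gser J v f = gser (I \<times> J) (\<lambda>(i, j). w i * v j) (\<lambda>(i, j). e i + f j)"
proof (rule fps_ext)
  fix N
  let ?S = "{x \<in> I \<times> J. (case x of (i, j) \<Rightarrow> e i + f j) = int N}"
  let ?g = "\<lambda>(i, j). nat (e i)" and ?h = "\<lambda>(i, j). w i * v j"
  have nn: "0 \<le> e i" "0 \<le> f j" if "i \<in> I" "j \<in> J" for i j
    using that properD(1)[OF assms(1)] properD(1)[OF assms(2)] by auto
  have fib: "{i\<in>I. e i = int k} \<times> {j\<in>J. f j = int (N - k)} = {x \<in> ?S. ?g x = k}" if "k \<le> N" for k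
  proof (rule set_eqI)
    fix x :: "'a \<times> 'b"
    obtain i j where "x = (i, j)" by (cases x)
    then show "x \<in> {i\<in>I. e i = int k} \<times> {j\<in>J. f j = int (N - k)} \<longleftrightarrow> x \<in> {x \<in> ?S. ?g x = k}"
      using that nn[of i j] by (auto simp: of_nat_diff)
  qed
  have "(gser I w e * gser J v f) $ N =
      (\<Sum>k=0..N. (\<Sum>i\<in>{i\<in>I. e i = int k}. w i) * (\<Sum>j\<in>{j\<in>J. f j = int (N - k)}. v j))"
    by (simp add: fps_mult_nth gser_nth)
  also have "\<dots> = (\<Sum>k=0..N. sum ?h ({i\<in>I. e i = int k} \<times> {j\<in>J. f j = int (N - k)}))"
    by (simp add: sum_product sum.cartesian_product)
  also have "\<dots> = (\<Sum>k=0..N. sum ?h {x \<in> ?S. ?g x = k})"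
    by (rule sum.cong[OF refl], rule arg_cong[of _ _ "sum ?h"], rule fib) simp
  also have "\<dots> = sum ?h ?S"
  proof (rule sum.group)
    show "finite ?S" by (rule properD(3)[OF proper_times[OF assms]])
    show "?g ` ?S \<subseteq> {0..N}" using nn by fastforce
  qed simp
  finally show "(gser I w e * gser J v f) $ N =
      gser (I \<times> J) (\<lambda>(i, j). w i * v j) (\<lambda>(i, j). e i + f j) $ N"
    by (simp add: gser_nth)
qed

lemma gser_reindex:
  assumes "\<And>i. i \<in> I \<Longrightarrow> g i \<in> J \<and> h (g i) = i"
    and "\<And>j. j \<in> J \<Longrightarrow> h j \<in> I \<and> g (h j) = j"
    and "\<And>i. i \<in> I \<Longrightarrow> w i = v (g i) \<and> e i = f (g i)"
  shows "gser I w e = gser J v f"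
proof (rule fps_ext)
  show "gser I w e $ N = gser J v f $ N" for N
    unfolding gser_nth
    by (rule sum.reindex_bij_witness[where i = h and j = g]) (use assms in auto)
qed

lemma gser_cong:
  assumes "\<And>i. i \<in> I \<Longrightarrow> w i = v i" "\<And>i. i \<in> I \<Longrightarrow> e i = f i"
  shows "gser I w e = gser I v f"
  by (rule gser_reindex[where g = id and h = id]) (use assms in auto)

lemma gser_add: "gser I w e + gser I v e = gser I (\<lambda>i. w i + v i) e"
  by (rule fps_ext) (simp add: gser_nth sum.distrib)

lemma gser_diff: "gser I w e - gser I v e = gser I (\<lambda>i. w i - v i) e"
  by (rule fps_ext) (simp add: gser_nth sum_subtractf)

lemma gser_uminus: "- gser I w e = gser I (\<lambda>i. - w i) e"
  by (rule fps_ext) (simp add: gser_nth sum_negf)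

lemma gser_const: "fps_const c * gser I w e = gser I (\<lambda>i. c * w i) e"
  by (rule fps_ext) (simp add: gser_nth sum_distrib_left)

lemma gser_numeral: "numeral c * gser I w e = gser I (\<lambda>i. numeral c * w i) e"
  using gser_const[of "numeral c"] by (simp flip: numeral_fps_const)

lemma gser_Un:
  assumes "proper (I \<union> J) e" "I \<inter> J = {}"
  shows "gser (I \<union> J) w e = gser I w e + gser J w e"
proof (rule fps_ext)
  fix N
  have "{i \<in> I \<union> J. e i = int N} = {i \<in> I. e i = int N} \<union> {i \<in> J. e i = int N}" by auto
  moreover have "finite {i \<in> I. e i = int N}" "finite {i \<in> J. e i = int N}"
    using assms(1) by (auto intro!: properD(3) elim: proper_subset)
  ultimately show "gser (I \<union> J) w e $ N = (gser I w e + gser J w e) $ N"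
    using assms(2) by (simp add: gser_nth, intro sum.union_disjoint) auto
qed

text \<open>Reindexing by \<open>h\<close> shows that the series equals its own negative. Fixed
  points are harmless, since the second hypothesis forces weight 0 there.\<close>

lemma gser_odd_involution:
  assumes "\<And>i. i \<in> I \<Longrightarrow> h i \<in> I \<and> h (h i) = i" "\<And>i. i \<in> I \<Longrightarrow> w (h i) = - w i"
    and "\<And>i. i \<in> I \<Longrightarrow> e (h i) = e i"
  shows "gser I w e = 0"
proof -
  have "gser I w e = gser I (\<lambda>i. - w i) e"
    by (rule gser_reindex[where g = h and h = h]) (use assms in auto)
  then have "gser I w e = - gser I w e" by (simp add: gser_uminus)
  then have "gser I w e $ N = - (gser I w e $ N)" for N by (metis fps_neg_nth)
  then show ?thesis by (intro fps_ext) (simp add: eq_neg_iff_add_eq_0)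
qed

lemma fps_XD_gser: "fps_XD (gser I w e) = gser I (\<lambda>i. e i * w i) e"
  by (rule fps_ext) (simp add: gser_nth sum_distrib_left)

lemma gser_compose_X_power:
  assumes "k > 0" "proper I e"
  shows "(gser I w e oo fps_X ^ k) = gser I w (\<lambda>i. int k * e i)"
proof (rule fps_ext)
  fix N
  show "(gser I w e oo fps_X ^ k) $ N = gser I w (\<lambda>i. int k * e i) $ N"
  proof (cases "k dvd N")
    case True
    then obtain M where "N = k * M" by auto
    with assms show ?thesis by (simp add: fps_nth_compose_X_power gser_nth)
  next
    case False
    then have "int k * e i \<noteq> int N" for i
      by (metis dvd_triv_left int_dvd_int_iff)
    with False assms show ?thesis by (simp add: fps_nth_compose_X_power gser_nth)
  qed
qed

lemma gser_compose_uminus: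
  "(gser I w e oo (- fps_X)) = gser I (\<lambda>i. (if even (e i) then 1 else - 1) * w i) e"
proof (rule fps_ext)
  fix N
  show "(gser I w e oo (- fps_X)) $ N = gser I (\<lambda>i. (if even (e i) then 1 else - 1) * w i) e $ N"
    unfolding fps_compose_uminus' by (cases "even N") (simp_all add: gser_nth sum_negf)
qed

text \<open>Frobenius modulo 2: off-diagonal pairs cancel in twos under swapping. The linear order
  only selects one pair from each swapped couple.\<close>

lemma gser_square:
  fixes e :: "'i :: linorder \<Rightarrow> int"
  assumes "proper I e"
  shows "\<exists>K. gser I w e ^ 2 = gser I (\<lambda>i. w i ^ 2) (\<lambda>i. 2 * e i) + 2 * K"
proof -
  let ?w = "\<lambda>(i, j). w i * w j" and ?e = "\<lambda>(i, j). e i + e j"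
  define A B C where "A = {x \<in> I \<times> I. fst x < snd x}" and "B = {x \<in> I \<times> I. fst x > snd x}"
    and "C = {x \<in> I \<times> I. fst x = snd x}"
  have p: "proper (I \<times> I) ?e" by (rule proper_times[OF assms assms])
  have "I \<times> I = A \<union> B \<union> C" by (auto simp: A_def B_def C_def)
  moreover have "gser (A \<union> B \<union> C) ?w ?e = gser A ?w ?e + gser B ?w ?e + gser C ?w ?e"
  proof -
    have "proper (A \<union> B \<union> C) ?e" "proper (A \<union> B) ?e"
      by (rule proper_subset[OF p], auto simp: A_def B_def C_def)+
    then show ?thesis by (subst gser_Un, simp, force simp: A_def B_def C_def,
          subst gser_Un) (auto simp: A_def B_def C_def)
  qed
  moreover have "gser B ?w ?e = gser A ?w ?e"
    by (rule gser_reindex[where g = prod.swap and h = prod.swap]) (auto simp: A_def B_def)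
  moreover have "gser C ?w ?e = gser I (\<lambda>i. w i ^ 2) (\<lambda>i. 2 * e i)"
    by (rule gser_reindex[where g = fst and h = "\<lambda>i. (i, i)"]) (auto simp: C_def power2_eq_square)
  moreover have "gser I w e ^ 2 = gser (I \<times> I) ?w ?e"
    unfolding power2_eq_square by (rule gser_mult[OF assms assms])
  ultimately have "gser I w e ^ 2 = gser I (\<lambda>i. w i ^ 2) (\<lambda>i. 2 * e i) + 2 * gser A ?w ?e"
    by simp
  then show ?thesis by blast
qed

section \<open>Products as series over sets of parts, and the generating function of
  \<open>DSOME\<close>\<close>

lemma qpoch_eq_gser:
  assumes "d > 0" "r > 0"
  shows "qpoch 1 d r = gser {A. finite A \<and> A \<subseteq> range (\<lambda>i. d * i + r)} (\<lambda>_. 1) (\<lambda>A. int (\<Sum>A))"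
proof (rule fps_ext)
  fix k
  let ?h = "\<lambda>i. d * i + r"
  have inj: "inj_on ?h B" for B using assms(1) by (auto simp: inj_on_def)
  have "qpoch 1 d r $ k = (\<Prod>i<k. fps_X ^ ?h i + 1 :: int fps) $ k"
    by (simp add: qpoch_def qpoch_fin_def add.commute)
  also have "(\<Prod>i<k. fps_X ^ ?h i + 1 :: int fps) = (\<Prod>x\<in>?h ` {..<k}. fps_X ^ x + 1)"
    by (simp add: prod.reindex[OF inj])
  also have "\<dots> = (\<Sum>A\<in>Pow (?h ` {..<k}). fps_X ^ (\<Sum>A))"
    by (subst prod_add) (simp_all add: power_sum)
  also have "\<dots> $ k = (\<Sum>A\<in>Pow (?h ` {..<k}). if k = \<Sum>A then 1 else 0)"
    by (simp add: fps_sum_nth)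
  also have "\<dots> = (\<Sum>A\<in>{A \<in> Pow (?h ` {..<k}). k = \<Sum>A}. 1)"
    by (subst sum.inter_filter) simp_all
  also have "{A \<in> Pow (?h ` {..<k}). k = \<Sum>A} = {A \<in> {A. finite A \<and> A \<subseteq> range ?h}. int (\<Sum>A) = int k}"
  proof -
    \<comment> \<open>The part with index \<open>i\<close> exceeds \<open>i\<close>, so a set of sum
      \<open>k\<close> uses only the first \<open>k\<close> exponents, those of the finite
      product.\<close>
    have sub: "A \<subseteq> ?h ` {..<k}" if A: "finite A" "A \<subseteq> range ?h" "k = \<Sum>A" for A
    proof
      fix x assume "x \<in> A"
      then obtain i where i: "x = d * i + r" using A(2) by auto
      have "x \<le> k" using member_le_sum[of x A "\<lambda>x. x"] \<open>x \<in> A\<close> A(1) unfolding A(3) by simp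
      moreover have "i \<le> d * i" using assms(1) by simp
      ultimately have "i < k" using i assms(2) by linarith
      then show "x \<in> ?h ` {..<k}" using i by (intro image_eqI[of _ _ i]) auto
    qed
    have fin: "finite A \<and> A \<subseteq> range ?h" if "A \<subseteq> ?h ` {..<k}" for A
      using that finite_subset[OF that] by blast
    show ?thesis
    proof (rule set_eqI)
      show "A \<in> {A \<in> Pow (?h ` {..<k}). k = \<Sum>A} \<longleftrightarrow>
          A \<in> {A \<in> {A. finite A \<and> A \<subseteq> range ?h}. int (\<Sum>A) = int k}" for A
        unfolding mem_Collect_eq Pow_iff of_nat_eq_iff using sub[of A] fin[of A] by metis
    qed
  qed
  finally show "qpoch 1 d r $ k =
      gser {A. finite A \<and> A \<subseteq> range ?h} (\<lambda>_. 1) (\<lambda>A. int (\<Sum>A)) $ k"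
    by (simp add: gser_nth)
qed

lemma proper_finite_sets:
  assumes "0 \<notin> P"
  shows "proper {A. finite A \<and> A \<subseteq> P} (\<lambda>A. int (\<Sum>A))"
  unfolding proper_def
proof (intro conjI allI)
  show "finite {A \<in> {A. finite A \<and> A \<subseteq> P}. int (\<Sum>A) \<le> N}" for N
  proof (rule finite_subset)
    show "{A \<in> {A. finite A \<and> A \<subseteq> P}. int (\<Sum>A) \<le> N} \<subseteq> Pow {..nat N}"
    proof clarsimp
      fix A x assume "finite A" "(\<Sum>x\<in>A. int x) \<le> N" "x \<in> A"
      with member_le_sum[of x A int] show "x \<le> nat N" by simp
    qed
  qed simp
qed (simp add: sum_nonneg)

lemma odd_range: "range (\<lambda>i. 2 * i + 1) = {k::nat. odd k}"
  by (auto elim: oddE)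

lemma pos_even_range: "range (\<lambda>i. 2 * i + 2) = {k::nat. even k \<and> 0 < k}"
proof (intro equalityI subsetI)
  fix k :: nat assume "k \<in> {k. even k \<and> 0 < k}"
  then have "k = 2 * (k div 2 - 1) + 2" by auto
  then show "k \<in> range (\<lambda>i. 2 * i + 2)" by (rule range_eqI)
qed auto

text \<open>\<open>fps_XD\<close> weights a set of parts by its sum, so the antisymmetric product
  rule weights a pair (odd parts, even parts) by the difference of the two sums. This is the
  logarithmic derivative with its denominators cleared.\<close>

lemma DSOME_gf:
  "Abs_fps DSOME = fps_XD (qpoch 1 2 1) * qpoch 1 2 2 - qpoch 1 2 1 * fps_XD (qpoch 1 2 2)"
proof -
  define I J where "I = {A::nat set. finite A \<and> A \<subseteq> {k. odd k}}"
    and "J = {A::nat set. finite A \<and> A \<subseteq> {k. even k \<and> 0 < k}}"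
  let ?s = "\<lambda>A. int (\<Sum>A)"
  have pI: "proper I ?s" and pJ: "proper J ?s"
    unfolding I_def J_def by (rule proper_finite_sets, simp)+
  have O: "qpoch 1 2 1 = gser I (\<lambda>_. 1) ?s"
    unfolding I_def odd_range [symmetric] by (rule qpoch_eq_gser) simp_all
  have F: "qpoch 1 2 2 = gser J (\<lambda>_. 1) ?s"
    unfolding J_def pos_even_range [symmetric] by (rule qpoch_eq_gser) simp_all
  have "fps_XD (qpoch 1 2 1) * qpoch 1 2 2 - qpoch 1 2 1 * fps_XD (qpoch 1 2 2) =
      gser (I \<times> J) (\<lambda>(A, B). ?s A - ?s B) (\<lambda>(A, B). ?s A + ?s B)"
    unfolding O F fps_XD_gser gser_mult[OF pI pJ] gser_diff
    by (rule gser_cong) auto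
  also have "\<dots> = gser {A. finite A \<and> (\<forall>k\<in>A. 0 < k)}
      (\<lambda>A. (\<Sum>k | k \<in> A \<and> odd k. int k) - (\<Sum>k | k \<in> A \<and> even k. int k)) ?s"
  proof (rule gser_reindex[where g = "\<lambda>(A, B). A \<union> B" and
        h = "\<lambda>A. ({k. k \<in> A \<and> odd k}, {k. k \<in> A \<and> even k})"])
    fix x assume "x \<in> I \<times> J"
    then obtain A B where x: "x = (A, B)" "A \<in> I" "B \<in> J" by auto
    then have fin: "finite A" "finite B" and odd: "\<And>k. k \<in> A \<Longrightarrow> odd k"
      and even: "\<And>k. k \<in> B \<Longrightarrow> even k" "\<And>k. k \<in> B \<Longrightarrow> 0 < k" by (auto simp: I_def J_def)
    have eq: "{k. k \<in> A \<union> B \<and> odd k} = A" "{k. k \<in> A \<union> B \<and> even k} = B"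
      using odd even by auto
    have pos: "0 < k" if "k \<in> A \<union> B" for k using that odd even by (auto simp: odd_pos)
    show "(case x of (A, B) \<Rightarrow> A \<union> B) \<in> {A. finite A \<and> (\<forall>k\<in>A. 0 < k)} \<and>
        ({k. k \<in> (case x of (A, B) \<Rightarrow> A \<union> B) \<and> odd k},
         {k. k \<in> (case x of (A, B) \<Rightarrow> A \<union> B) \<and> even k}) = x"
      using eq fin pos by (simp add: x(1))
    have "A \<inter> B = {}" using odd even by auto
    then have "?s (A \<union> B) = ?s A + ?s B" using fin by (simp add: sum.union_disjoint)
    then show "(case x of (A, B) \<Rightarrow> ?s A - ?s B) =
        (\<Sum>k | k \<in> (case x of (A, B) \<Rightarrow> A \<union> B) \<and> odd k. int k) -
        (\<Sum>k | k \<in> (case x of (A, B) \<Rightarrow> A \<union> B) \<and> even k. int k) \<and>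
        (case x of (A, B) \<Rightarrow> ?s A + ?s B) = ?s (case x of (A, B) \<Rightarrow> A \<union> B)"
      using eq by (simp add: x(1))
  next
    fix A :: "nat set" assume "A \<in> {A. finite A \<and> (\<forall>k\<in>A. 0 < k)}"
    then show "({k. k \<in> A \<and> odd k}, {k. k \<in> A \<and> even k}) \<in> I \<times> J \<and>
        (case ({k. k \<in> A \<and> odd k}, {k. k \<in> A \<and> even k}) of (A, B) \<Rightarrow> A \<union> B) = A"
      by (auto simp: I_def J_def)
  qed
  also have "\<dots> = Abs_fps DSOME"
    by (rule fps_ext) (simp only: gser_nth DSOME_def distinct_partitions_def fps_nth_Abs_fps mem_Collect_eq
        conj_assoc of_nat_eq_iff)
  finally show ?thesis by (rule sym)
qed

section \<open>The Jacobi triple product\<close>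

fun gauss_binom :: "'a::comm_ring_1 \<Rightarrow> nat \<Rightarrow> nat \<Rightarrow> 'a" where
  "gauss_binom y n 0 = 1"
| "gauss_binom y 0 (Suc k) = 0"
| "gauss_binom y (Suc n) (Suc k) = gauss_binom y n k + y ^ Suc k * gauss_binom y n (Suc k)"

lemma gauss_binom_eq_0: "n < k \<Longrightarrow> gauss_binom y n k = 0"
  by (induction y n k rule: gauss_binom.induct) auto

text \<open>The quotient formula for Gaussian binomials without division. The induction step rests
  on (1 - y^k) + y^k (1 - y^l) = 1 - y^(k + l).\<close>

lemma gauss_binom_prod:
  fixes y :: "'a::comm_ring_1"
  defines "P \<equiv> \<lambda>n. \<Prod>i<n. 1 - y ^ Suc i"
  shows "gauss_binom y (k + l) k * (P k * P l) = P (k + l)"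
proof (induction "k + l" arbitrary: k l)
  case (Suc n)
  show ?case
  proof (cases k)
    case 0
    then show ?thesis by (simp add: P_def)
  next
    case k: (Suc k')
    show ?thesis
    proof (cases l)
      case 0
      have PS: "P (Suc i) = P i * (1 - y ^ Suc i)" for i by (simp add: P_def)
      from 0 k Suc.hyps(2) have n: "n = k'" by simp
      have IH: "gauss_binom y k' k' * (P k' * P 0) = P k'" using Suc.hyps(1)[of k' 0] n by simp
      have "gauss_binom y (Suc k') (Suc k') * (P (Suc k') * P 0)
          = (gauss_binom y k' k' * (P k' * P 0)) * (1 - y ^ Suc k')"
        by (simp add: PS gauss_binom_eq_0 mult.assoc)
      also have "\<dots> = P (Suc k')" by (simp only: IH PS)
      finally show ?thesis by (simp only: k 0 add_0_right)
    next
      case l: (Suc l')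
      have PS: "P (Suc i) = P i * (1 - y ^ Suc i)" for i by (simp add: P_def)
      from k l Suc.hyps(2) have n: "n = k' + l" "n = k + l'" by simp_all
      have IH: "gauss_binom y n k' * (P k' * P l) = P n" "gauss_binom y n k * (P k * P l') = P n"
        using Suc.hyps(1)[of k' l] Suc.hyps(1)[of k l'] n by auto
      have "gauss_binom y (Suc n) (Suc k') * (P (Suc k') * P (Suc l'))
        = (gauss_binom y n k' * (P k' * P l)) * (1 - y ^ Suc k')
          + y ^ Suc k' * (1 - y ^ Suc l') * (gauss_binom y n k * (P k * P l'))"
        by (simp add: k l PS del: power_Suc) (simp add: algebra_simps del: power_Suc)
      also have "\<dots> = P n * (1 - y ^ Suc k' * y ^ Suc l')"
        unfolding IH by (simp add: algebra_simps del: power_Suc)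
      also have "y ^ Suc k' * y ^ Suc l' = y ^ Suc n"
        unfolding power_add [symmetric] using n(1) l by simp
      finally show ?thesis using n k l by (simp add: PS del: power_Suc gauss_binom.simps)
    qed
  qed
qed (simp add: P_def)

text \<open>Splitting off the factor at \<open>i = 0\<close> turns \<open>x\<close> into
  \<open>x * y\<close> in the remaining ones, hence the induction with \<open>x\<close>
  arbitrary.\<close>

lemma cauchy_binomial:
  fixes x y :: "'a::comm_ring_1"
  shows "(\<Prod>i<m. 1 + x * y ^ i) = (\<Sum>k\<le>m. gauss_binom y m k * (x ^ k * y ^ (k choose 2)))"
proof (induction m arbitrary: x)
  case (Suc m)
  define S where "S = (\<Sum>k\<le>m. gauss_binom y m k * ((x * y) ^ k * y ^ (k choose 2)))"
  have ch: "Suc k choose 2 = k + (k choose 2)" for k by (simp add: numeral_2_eq_2)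
  have ch0: "(0::nat) choose 2 = 0" by (simp add: numeral_2_eq_2)
  have "(\<Prod>i<Suc m. 1 + x * y ^ i) = (1 + x) * (\<Prod>i<m. 1 + (x * y) * y ^ i)"
    by (simp add: prod.lessThan_Suc_shift mult.assoc del: prod.lessThan_Suc)
  also have "\<dots> = (1 + x) * S" by (simp only: Suc.IH S_def)
  also have "x * S = (\<Sum>k\<le>m. gauss_binom y m k * (x ^ Suc k * y ^ (Suc k choose 2)))"
    unfolding S_def sum_distrib_left
    by (rule sum.cong) (simp_all add: ch power_mult_distrib power_add)
  moreover have "S = (\<Sum>k\<le>Suc m. gauss_binom y m k * ((x * y) ^ k * y ^ (k choose 2)))"
    by (simp add: S_def gauss_binom_eq_0)
  then have "S = 1 + (\<Sum>k\<le>m. y ^ Suc k * gauss_binom y m (Suc k) * (x ^ Suc k * y ^ (Suc k choose 2)))"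
    by (subst (asm) sum.atMost_Suc_shift) (simp add: power_mult_distrib mult_ac ch0)
  ultimately show ?case
    by (subst sum.atMost_Suc_shift)
      (simp add: distrib_right sum.distrib algebra_simps ch0 del: power_Suc)
qed (simp add: numeral_2_eq_2)

text \<open>The summand of Ramanujan's two-variable theta function f(a, b). Both exponents are
  nonnegative for every integer \<open>j\<close>, so \<open>nat\<close> loses nothing.\<close>

definition jac_term :: "'a::comm_ring_1 \<Rightarrow> 'a \<Rightarrow> int \<Rightarrow> 'a" where
  "jac_term a b j = a ^ nat (j * (j + 1) div 2) * b ^ nat (j * (j - 1) div 2)"

text \<open>A truncation of f(a, b) with a weight: \<open>v = 1\<close> yields the triple product,
  \<open>v j = j\<close> its derivative.\<close>

definition jac_sum :: "'a::comm_ring_1 \<Rightarrow> 'a \<Rightarrow> (int \<Rightarrow> 'a) \<Rightarrow> nat \<Rightarrow> nat \<Rightarrow> 'a" where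
  "jac_sum a b v M n = (\<Sum>k\<le>M. gauss_binom (a * b) M k *
     (v (int k - int n) * jac_term a b (int k - int n)))"

lemma two_tri: "2 * (j * (j + 1) div 2) = j * (j + 1)" for j :: int
  by simp

lemma two_tri': "2 * (j * (j - 1) div 2) = j * (j - 1)" for j :: int
  by simp

lemma tri_nonneg: "0 \<le> j * (j + 1) div 2" "0 \<le> j * (j - 1) div 2" for j :: int
proof -
  have "0 \<le> j * (j + 1)" by (cases "0 \<le> j") (auto simp: zero_le_mult_iff)
  then show "0 \<le> j * (j + 1) div 2" by simp
  have "0 \<le> j * (j - 1)" by (cases "0 < j") (auto simp: zero_le_mult_iff)
  then show "0 \<le> j * (j - 1) div 2" by simp
qed

lemma jac_term_step:
  "jac_term a b (int k - int n) * b * (a * b) ^ n = (a * b) ^ k * jac_term a b (int k - int n - 1)"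
proof -
  define j where "j = int k - int n"
  have s: "j * (j + 1) div 2 + int n = int k + (j - 1) * (j - 1 + 1) div 2"
    "j * (j - 1) div 2 + 1 + int n = int k + (j - 1) * (j - 1 - 1) div 2"
    using two_tri[of j] two_tri'[of j] two_tri[of "j - 1"] two_tri'[of "j - 1"]
    unfolding j_def by (simp_all add: algebra_simps)
  have A: "nat (j * (j + 1) div 2) + n = k + nat ((j - 1) * (j - 1 + 1) div 2)"
    using s(1) tri_nonneg[of j] tri_nonneg[of "j - 1"] by linarith
  have B: "nat (j * (j - 1) div 2) + 1 + n = k + nat ((j - 1) * (j - 1 - 1) div 2)"
    using s(2) tri_nonneg[of j] tri_nonneg[of "j - 1"] by linarith
  have "jac_term a b j * b * (a * b) ^ n
      = a ^ (nat (j * (j + 1) div 2) + n) * b ^ (nat (j * (j - 1) div 2) + 1 + n)"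
    by (simp only: jac_term_def power_add power_mult_distrib power_one_right mult_ac)
  also have "\<dots> = (a * b) ^ k * jac_term a b (j - 1)"
    unfolding A B by (simp only: jac_term_def power_add power_mult_distrib mult_ac)
  finally show ?thesis by (simp only: j_def)
qed

text \<open>Pascal's rule splits the sum, and \<open>jac_term_step\<close> reindexes the second half
  by one, which the weight sees as \<open>v (j - 1)\<close>. A constant weight just gains the factor
  \<open>1 + b * (a * b) ^ n\<close>; a linear one also produces an unweighted sum.\<close>

lemma jac_sum_Suc:
  "jac_sum a b v (Suc M) (Suc n) =
     jac_sum a b v M n + b * (a * b) ^ n * jac_sum a b (\<lambda>j. v (j - 1)) M n"
proof -
  define y where "y = a * b"
  define c where "c = jac_term a b"
  have idx: "int (Suc k) - int (Suc n) = int k - int n" "int k - int (Suc n) = int k - int n - 1"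
    "int (Suc k) - int n - 1 = int k - int n" for k
    by simp_all
  have "jac_sum a b v (Suc M) (Suc n) = v (int 0 - int n - 1) * c (int 0 - int n - 1) +
      (\<Sum>k\<le>M. (gauss_binom y M k + y ^ Suc k * gauss_binom y M (Suc k)) * (v (int k - int n) * c (int k - int n)))"
    unfolding jac_sum_def y_def [symmetric] c_def [symmetric]
    by (subst sum.atMost_Suc_shift) (simp only: idx gauss_binom.simps mult_1_left)
  also have "\<dots> = jac_sum a b v M n + (v (int 0 - int n - 1) * c (int 0 - int n - 1) +
      (\<Sum>k\<le>M. y ^ Suc k * gauss_binom y M (Suc k) * (v (int k - int n) * c (int k - int n))))"
    unfolding jac_sum_def y_def [symmetric] c_def [symmetric]
    by (simp only: distrib_right sum.distrib) (simp only: ac_simps)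
  also have "v (int 0 - int n - 1) * c (int 0 - int n - 1) +
      (\<Sum>k\<le>M. y ^ Suc k * gauss_binom y M (Suc k) * (v (int k - int n) * c (int k - int n)))
    = (\<Sum>k\<le>Suc M. y ^ k * gauss_binom y M k * (v (int k - int n - 1) * c (int k - int n - 1)))"
    by (subst sum.atMost_Suc_shift) simp
  also have "\<dots> = (\<Sum>k\<le>M. y ^ k * gauss_binom y M k * (v (int k - int n - 1) * c (int k - int n - 1)))"
    by (simp add: gauss_binom_eq_0)
  also have "\<dots> = b * y ^ n * jac_sum a b (\<lambda>j. v (j - 1)) M n"
    unfolding jac_sum_def y_def [symmetric] c_def [symmetric] sum_distrib_left
  proof (rule sum.cong)
    fix k
    have "y ^ k * gauss_binom y M k * (v (int k - int n - 1) * c (int k - int n - 1)) =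
        gauss_binom y M k * v (int k - int n - 1) * (y ^ k * c (int k - int n - 1))"
      by (simp only: mult_ac)
    also have "y ^ k * c (int k - int n - 1) = c (int k - int n) * b * y ^ n"
      unfolding y_def c_def by (rule jac_term_step[symmetric])
    finally show "y ^ k * gauss_binom y M k * (v (int k - int n - 1) * c (int k - int n - 1)) =
        b * y ^ n * (gauss_binom y M k * (v (int k - int n - 1) * c (int k - int n)))"
      by (simp only: mult_ac)
  qed simp
  finally show ?thesis by (simp only: y_def)
qed

lemma jac_sum_diff:
  "jac_sum a b (\<lambda>j. v j - w j) M n = jac_sum a b v M n - jac_sum a b w M n"
  by (simp add: jac_sum_def left_diff_distrib right_diff_distrib sum_subtractf)

lemma finite_jacobi_triple_product:
  "jac_sum a b (\<lambda>_. 1) (m + n) n = (\<Prod>i<m. 1 + a * (a * b) ^ i) * (\<Prod>i<n. 1 + b * (a * b) ^ i)"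
proof (induction n)
  case 0
  have "jac_term a b (int k) = a ^ k * (a * b) ^ (k choose 2)" for k
  proof -
    have "int k * (int k - 1) div 2 = int (k choose 2)"
      unfolding choose_two by (cases k) (simp_all add: zdiv_int algebra_simps)
    moreover have "int k * (int k + 1) div 2 = int k * (int k - 1) div 2 + int k"
      using two_tri[of "int k"] two_tri'[of "int k"] by (simp add: algebra_simps)
    ultimately have "nat (int k * (int k - 1) div 2) = k choose 2"
      "nat (int k * (int k + 1) div 2) = (k choose 2) + k" by simp_all
    then show ?thesis
      by (simp only: jac_term_def power_add power_mult_distrib mult_ac)
  qed
  then show ?case by (simp add: jac_sum_def cauchy_binomial)
next
  case (Suc n)
  have "jac_sum a b (\<lambda>_. 1) (m + Suc n) (Suc n) = (1 + b * (a * b) ^ n) * jac_sum a b (\<lambda>_. 1) (m + n) n"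
    by (simp only: add_Suc_right jac_sum_Suc distrib_right mult_1_left)
  with Suc show ?case by (simp add: mult_ac)
qed

text \<open>The triple product vanishes at \<open>b = -1\<close>; this is its derivative there.\<close>

lemma finite_jacobi_cube:
  "jac_sum a (- 1) of_int (m + Suc n) (Suc n) = (\<Prod>i<m. 1 + a * (- a) ^ i) * (\<Prod>i<n. 1 - (- a) ^ Suc i)"
proof (induction n)
  \<comment> \<open>At \<open>n = 0\<close> the first coefficient is 1 - 1 = 0 and only the
    unweighted sum survives. Later the unweighted sum vanishes, because its product contains the
    factor 1 + b = 0.\<close>
  have step: "jac_sum a (- 1) of_int (Suc M) (Suc n) =
      (1 - (- a) ^ n) * jac_sum a (- 1) of_int M n + (- a) ^ n * jac_sum a (- 1) (\<lambda>_. 1) M n" for M n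
    unfolding jac_sum_Suc of_int_diff of_int_1 jac_sum_diff by (simp add: algebra_simps)
  {
    case 0
    show ?case
      using finite_jacobi_triple_product[of a "- 1" m 0] by (simp add: step)
  next
    case (Suc n)
    have "jac_sum a (- 1) (\<lambda>_. 1) (m + Suc n) (Suc n) = 0"
      unfolding finite_jacobi_triple_product by (simp add: prod.lessThan_Suc_shift del: prod.lessThan_Suc)
    then have "jac_sum a (- 1) of_int (m + Suc (Suc n)) (Suc (Suc n)) =
        (1 - (- a) ^ Suc n) * jac_sum a (- 1) of_int (m + Suc n) (Suc n)"
      by (simp only: add_Suc_right step[of "m + Suc n" "Suc n", simplified add_Suc_right]) simp
    also have "\<dots> = (\<Prod>i<m. 1 + a * (- a) ^ i) * (\<Prod>i<Suc n. 1 - (- a) ^ Suc i)"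
      unfolding Suc by (simp only: prod.lessThan_Suc mult_ac)
    finally show ?case .
  }
qed

section \<open>Passage to the limit, and the classical product identities\<close>

lemma qpoch_fin_nth_small: "k < r \<Longrightarrow> qpoch_fin s d r n $ k = (1 :: int fps) $ k"
proof (induction n)
  case (Suc n)
  have "qpoch_fin s d r (Suc n) = qpoch_fin s d r n + fps_const s * (fps_X ^ (d * n + r) * qpoch_fin s d r n)"
    by (simp add: qpoch_fin_Suc algebra_simps)
  with Suc show ?case by (simp add: fps_X_power_mult_nth)
qed simp

text \<open>At a fixed offset from the middle, the Gaussian binomial tends to the reciprocal of the
  infinite product. Times a finite product it is a product of factors with exponents beyond
  \<open>d * (n + j)\<close>, hence tends to 1; exchanging that finite product for its limit costs a
  null sequence.\<close>

lemma gauss_binom_tendsto: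
  assumes d: "d > 0"
  shows "(\<lambda>n. qpoch (- 1) d d * gauss_binom (fps_X ^ d) (n + n) (nat (int n + j))) \<longlonglongrightarrow> 1"
proof -
  define P where "P = qpoch_fin (- 1) d d"
  define G where "G = (\<lambda>n. gauss_binom (fps_X ^ d :: int fps) (n + n) (nat (int n + j)))"
  define l where "l = (\<lambda>n. nat (int n - j))"
  have "(fps_X ^ d) ^ Suc i = (fps_X :: int fps) ^ (d * i + d)" for i
    unfolding power_mult [symmetric] mult_Suc_right by (simp only: add.commute)
  then have P: "P n = (\<Prod>i<n. 1 - (fps_X ^ d) ^ Suc i)" for n
    unfolding P_def qpoch_fin_def
    by (intro prod.cong) (simp_all del: power_Suc flip: fps_const_neg)
  have PG: "P (l n) * G n = qpoch_fin (- 1) d (d * Suc (nat (int n + j))) (l n)" if "\<bar>j\<bar> \<le> int n" for n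
  proof -
    define k where "k = nat (int n + j)"
    have kl: "k + l n = n + n" using that by (simp add: k_def l_def)
    have "P (m + i) = P m * qpoch_fin (- 1) d (d * Suc m) i" for m i
    proof (induction i)
      case (Suc i)
      have "d * (m + i) + d = d * i + d * Suc m" by (simp add: algebra_simps)
      then show ?case
        using Suc unfolding P_def add_Suc_right qpoch_fin_Suc by (simp only: mult.assoc)
    qed simp
    moreover have Gk: "gauss_binom (fps_X ^ d) (k + l n) k = G n"
      unfolding kl by (simp only: G_def k_def)
    have "G n * (P k * P (l n)) = P (k + l n)"
      using gauss_binom_prod[of "fps_X ^ d :: int fps" k "l n"]
      unfolding P [symmetric] Gk .
    ultimately have "P k * (P (l n) * G n) = P k * qpoch_fin (- 1) d (d * Suc k) (l n)"
      by (simp only: mult_ac)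
    moreover have "P k \<noteq> 0" unfolding P_def using d by (rule qpoch_fin_nonzero)
    ultimately have "P (l n) * G n = qpoch_fin (- 1) d (d * Suc k) (l n)"
      by (simp only: mult_cancel_left) simp
    then show ?thesis by (simp only: k_def)
  qed
  have "(\<lambda>n. P (l n) * G n) \<longlonglongrightarrow> 1"
  proof (rule tendsto_fpsI)
    fix i
    show "eventually (\<lambda>n. (P (l n) * G n) $ i = 1 $ i) sequentially"
      using eventually_ge_at_top[of "nat \<bar>j\<bar> + i"]
    proof eventually_elim
      case (elim n)
      then have "\<bar>j\<bar> \<le> int n" "i < Suc (nat (int n + j))" by linarith+
      moreover have "m \<le> d * m" for m using d by simp
      note this[of "Suc (nat (int n + j))"]
      ultimately have "i < d * Suc (nat (int n + j))" by linarith
      then show ?case unfolding PG[OF \<open>\<bar>j\<bar> \<le> int n\<close>] by (rule qpoch_fin_nth_small)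
    qed
  qed
  moreover have "(\<lambda>n. (qpoch (- 1) d d - P (l n)) * G n) \<longlonglongrightarrow> 0"
  proof (rule tendsto_mult_zero_fps, rule tendsto_fpsI)
    fix i
    show "eventually (\<lambda>n. (qpoch (- 1) d d - P (l n)) $ i = 0 $ i) sequentially"
      using eventually_ge_at_top[of "nat \<bar>j\<bar> + i"]
    proof eventually_elim
      case (elim n)
      then have "i \<le> l n" unfolding l_def by linarith
      from qpoch_fin_nth_stable[OF d d this]
      have "P (l n) $ i = qpoch (- 1) d d $ i" unfolding P_def qpoch_def fps_nth_Abs_fps .
      then show ?case by simp
    qed
  qed
  ultimately have "(\<lambda>n. P (l n) * G n + (qpoch (- 1) d d - P (l n)) * G n) \<longlonglongrightarrow> 1 + 0"
    by (rule tendsto_add_fps)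
  moreover have "P (l n) * G n + (qpoch (- 1) d d - P (l n)) * G n = qpoch (- 1) d d * G n" for n
    by (simp add: algebra_simps)
  ultimately show ?thesis unfolding G_def by (simp only: add_0_right)
qed

definition jac_exp :: "nat \<Rightarrow> nat \<Rightarrow> int \<Rightarrow> int" where
  "jac_exp \<alpha> \<beta> j = int \<alpha> * (j * (j + 1) div 2) + int \<beta> * (j * (j - 1) div 2)"

lemma jac_exp_nonneg: "0 \<le> jac_exp \<alpha> \<beta> j"
  unfolding jac_exp_def by (intro add_nonneg_nonneg mult_nonneg_nonneg tri_nonneg of_nat_0_le_iff)

lemma proper_jac_exp:
  assumes "\<alpha> > 0 \<or> \<beta> > 0"
  shows "proper UNIV (jac_exp \<alpha> \<beta>)"
proof (rule properI_abs)
  fix j :: int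
  have "\<bar>j\<bar> - 1 \<le> j * (j + 1) div 2" "\<bar>j\<bar> - 1 \<le> j * (j - 1) div 2"
  proof -
    have "0 \<le> (\<bar>j\<bar> - 1) * (\<bar>j\<bar> - 2)"
      by (cases "\<bar>j\<bar> \<ge> 2") (auto simp: zero_le_mult_iff)
    then have "3 * \<bar>j\<bar> \<le> j * j + 2" by (simp add: algebra_simps)
    moreover have "j * (j + 1) \<ge> j * j - \<bar>j\<bar>" "j * (j - 1) \<ge> j * j - \<bar>j\<bar>"
      by (simp_all add: algebra_simps abs_if)
    ultimately show "\<bar>j\<bar> - 1 \<le> j * (j + 1) div 2" "\<bar>j\<bar> - 1 \<le> j * (j - 1) div 2"
      by linarith+
  qed
  moreover have ge: "x \<le> int c * x" if "c > 0" "0 \<le> x" for c x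
    using that mult_right_mono[of 1 "int c" x] by simp
  moreover have "0 \<le> int c * x" if "0 \<le> x" for c x using that by simp
  ultimately show "\<bar>j\<bar> - 1 \<le> jac_exp \<alpha> \<beta> j"
    using assms tri_nonneg[of j] ge[of \<alpha> "j * (j + 1) div 2"] ge[of \<beta> "j * (j - 1) div 2"]
    unfolding jac_exp_def by (meson add_increasing add_increasing2 order_trans)
qed (rule jac_exp_nonneg)

text \<open>Stands for \<open>s^j\<close> with \<open>s\<close> equal to 1 or -1, where
  \<open>j\<close> may be negative.\<close>

definition sgn_pow :: "int \<Rightarrow> int \<Rightarrow> int" where
  "sgn_pow s j = (if even j then 1 else s)"

lemma jac_term_monom:
  assumes "s = 1 \<or> s = - 1"
  shows "jac_term (fps_const s * fps_X ^ \<alpha>) (fps_const s * fps_X ^ \<beta>) j =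
    fps_const (sgn_pow s j) * fps_X ^ nat (jac_exp \<alpha> \<beta> j)"
proof -
  define A B where "A = nat (j * (j + 1) div 2)" and "B = nat (j * (j - 1) div 2)"
  have AB: "int A = j * (j + 1) div 2" "int B = j * (j - 1) div 2"
    unfolding A_def B_def using tri_nonneg[of j] by (simp_all only: nat_0_le)
  have "2 * int A + 2 * int B = j * (j + 1) + j * (j - 1)"
    unfolding AB two_tri two_tri' ..
  \<comment> \<open>The two powers of \<open>s\<close> combine to exponent j^2, which has the parity
    of \<open>j\<close>.\<close>
  then have "int (A + B) = j * j" by (simp add: algebra_simps)
  then have "even (A + B) \<longleftrightarrow> even j" by (metis even_mult_iff even_of_nat)
  then have sg: "s ^ (A + B) = sgn_pow s j" 
    using assms by (auto simp: sgn_pow_def minus_one_power_iff simp del: even_add)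
  have "int \<alpha> * int A + int \<beta> * int B = jac_exp \<alpha> \<beta> j"
    unfolding jac_exp_def AB ..
  then have e: "nat (jac_exp \<alpha> \<beta> j) = \<alpha> * A + \<beta> * B"
    by (metis nat_int of_nat_add of_nat_mult)
  show ?thesis
    unfolding jac_term_def A_def [symmetric] B_def [symmetric] e sg [symmetric]
    by (simp add: power_mult_distrib power_add fps_const_power mult_ac flip: fps_const_mult power_mult)
qed

text \<open>The prefactor turns each Gaussian binomial into a series tending to 1, and only finitely
  many \<open>j\<close> affect a given coefficient. The limit \<open>r\<close> is left as a
  hypothesis so that the weighted sums and the boundary case \<beta> = 0 are covered by the same
  argument.\<close>

lemma jacobi_limit:
  fixes v :: "int \<Rightarrow> int"
  assumes s: "s = 1 \<or> s = - 1" and d: "\<alpha> + \<beta> > 0"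
    and lim: "(\<lambda>n. jac_sum (fps_const s * fps_X ^ \<alpha>) (fps_const s * fps_X ^ \<beta>)
            (\<lambda>j. fps_const (v j)) (n + n) n) \<longlonglongrightarrow> r"
  shows "qpoch (- 1) (\<alpha> + \<beta>) (\<alpha> + \<beta>) * r = gser UNIV (\<lambda>j. v j * sgn_pow s j) (jac_exp \<alpha> \<beta>)"
proof (rule LIMSEQ_unique)
  define Y where "Y = qpoch (- 1) (\<alpha> + \<beta>) (\<alpha> + \<beta>)"
  define a b :: "int fps" where "a = fps_const s * fps_X ^ \<alpha>" and "b = fps_const s * fps_X ^ \<beta>"
  define e w where "e = jac_exp \<alpha> \<beta>" and "w = (\<lambda>j. v j * sgn_pow s j)"
  define R where "R = (\<lambda>n. jac_sum a b (\<lambda>j. fps_const (v j)) (n + n) n)"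
  show "(\<lambda>n. Y * R n) \<longlonglongrightarrow> Y * r"
    using lim unfolding R_def a_def b_def
    by (intro tendsto_mult_fps) (auto simp: tendsto_fps_iff)
  define T where "T = (\<lambda>n k. Y * gauss_binom (fps_X ^ (\<alpha> + \<beta>)) (n + n) k)"
  have T: "(\<lambda>n. T n (nat (int n + j))) \<longlonglongrightarrow> 1" for j
    unfolding T_def Y_def by (rule gauss_binom_tendsto[OF d])
  have p: "proper UNIV e" unfolding e_def using d by (intro proper_jac_exp) auto
  have ab: "a * b = fps_X ^ (\<alpha> + \<beta>)"
    using s by (auto simp: a_def b_def power_add simp flip: fps_const_neg)
  have YR: "Y * R n = (\<Sum>k\<le>n + n. fps_const (w (int k - int n)) * (fps_X ^ nat (e (int k - int n)) * T n k))" for n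
    unfolding R_def jac_sum_def sum_distrib_left
  proof (rule sum.cong)
    fix k
    have "jac_term a b (int k - int n) =
        fps_const (sgn_pow s (int k - int n)) * fps_X ^ nat (e (int k - int n))"
      unfolding a_def b_def e_def by (rule jac_term_monom[OF s])
    then show "Y * (gauss_binom (a * b) (n + n) k * (fps_const (v (int k - int n)) * jac_term a b (int k - int n))) =
        fps_const (w (int k - int n)) * (fps_X ^ nat (e (int k - int n)) * T n k)"
      unfolding ab T_def w_def by (simp add: mult_ac flip: fps_const_mult)
  qed simp
  show "(\<lambda>n. Y * R n) \<longlonglongrightarrow> gser UNIV w e"
  proof (rule tendsto_fpsI)
    fix N
    define J where "J = {j. e j \<le> int N}"
    have fin: "finite J" using properD(2)[OF p, of "int N"] by (simp add: J_def)
    have "eventually (\<lambda>n. \<forall>j\<in>J. \<forall>i\<in>{..N}. T n (nat (int n + j)) $ i = 1 $ i) sequentially"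
      using T by (auto simp: eventually_ball_finite_distrib fin tendsto_fps_iff)
    moreover have "eventually (\<lambda>n. \<forall>j\<in>J. n \<ge> nat \<bar>j\<bar>) sequentially"
      by (auto simp: eventually_ball_finite_distrib fin eventually_ge_at_top)
    ultimately show "eventually (\<lambda>n. (Y * R n) $ N = gser UNIV w e $ N) sequentially"
    proof eventually_elim
      case (elim n)
      have "(Y * R n) $ N = (\<Sum>k\<le>n + n. w (int k - int n) * (fps_X ^ nat (e (int k - int n)) * T n k) $ N)"
        unfolding YR by (simp add: fps_sum_nth)
      also have "\<dots> = (\<Sum>k\<le>n + n. if e (int k - int n) = int N then w (int k - int n) else 0)"
      proof (rule sum.cong)
        fix k
        define j where "j = int k - int n"
        have k: "k = nat (int n + j)" by (simp add: j_def)
        have e0: "0 \<le> e j" by (simp add: e_def jac_exp_nonneg)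
        have "(fps_X ^ nat (e j) * T n k) $ N = (if e j = int N then 1 else 0)"
        proof (cases "j \<in> J")
          case True
          then have "T n k $ (N - nat (e j)) = 1 $ (N - nat (e j))" using elim(1) k by auto
          moreover have "nat (e j) \<le> N" using True by (simp add: J_def)
          ultimately show ?thesis using e0 by (auto simp: fps_X_power_mult_nth)
        next
          case False
          then have "N < nat (e j)" by (simp add: J_def zless_nat_eq_int_zless)
          then show ?thesis by (auto simp: fps_X_power_mult_nth)
        qed
        then show "w (int k - int n) * (fps_X ^ nat (e (int k - int n)) * T n k) $ N =
            (if e (int k - int n) = int N then w (int k - int n) else 0)"
          by (simp add: j_def)
      qed simp
      also have "\<dots> = (\<Sum>k\<in>{k\<in>{..n + n}. e (int k - int n) = int N}. w (int k - int n))"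
        by (rule sum.inter_filter [symmetric]) simp
      also have "\<dots> = (\<Sum>j\<in>{j\<in>UNIV. e j = int N}. w j)"
      proof (rule sum.reindex_bij_witness[where i = "\<lambda>j. nat (int n + j)" and j = "\<lambda>k. int k - int n"])
        fix j assume "j \<in> {j \<in> UNIV. e j = int N}"
        then have "j \<in> J" by (simp add: J_def)
        with elim(2) have "nat \<bar>j\<bar> \<le> n" by auto
        then show "int (nat (int n + j)) - int n = j" "nat (int n + j) \<in> {k\<in>{..n + n}. e (int k - int n) = int N}"
          using \<open>j \<in> {j \<in> UNIV. e j = int N}\<close> by auto
      qed auto
      finally show ?case by (simp only: gser_nth)
    qed
  qed
qed

lemma prod_eq_qpoch_fin:
  "(\<Prod>i<n. 1 + (fps_const s * fps_X ^ r) * (fps_X ^ d) ^ i) = qpoch_fin s d r n"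
  unfolding qpoch_fin_def
  by (rule prod.cong) (simp_all add: power_add mult_ac flip: power_mult)

theorem jacobi_triple_product:
  assumes s: "s = 1 \<or> s = - 1" and "\<alpha> > 0" "\<beta> > 0"
  shows "qpoch (- 1) (\<alpha> + \<beta>) (\<alpha> + \<beta>) * (qpoch s (\<alpha> + \<beta>) \<alpha> * qpoch s (\<alpha> + \<beta>) \<beta>) =
    gser UNIV (sgn_pow s) (jac_exp \<alpha> \<beta>)"
proof -
  have ab: "(fps_const s * fps_X ^ \<alpha>) * (fps_const s * fps_X ^ \<beta>) = (fps_X :: int fps) ^ (\<alpha> + \<beta>)"
    using s by (auto simp: power_add simp flip: fps_const_neg)
  have "jac_sum (fps_const s * fps_X ^ \<alpha>) (fps_const s * fps_X ^ \<beta>) (\<lambda>j. fps_const 1) (n + n) n =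
      qpoch_fin s (\<alpha> + \<beta>) \<alpha> n * qpoch_fin s (\<alpha> + \<beta>) \<beta> n" for n
    unfolding fps_const_1_eq_1 finite_jacobi_triple_product ab prod_eq_qpoch_fin ..
  moreover have "(\<lambda>n. qpoch_fin s (\<alpha> + \<beta>) \<alpha> n * qpoch_fin s (\<alpha> + \<beta>) \<beta> n) \<longlonglongrightarrow>
      qpoch s (\<alpha> + \<beta>) \<alpha> * qpoch s (\<alpha> + \<beta>) \<beta>"
    using assms by (intro tendsto_mult_fps qpoch_tendsto) auto
  ultimately have lim: "(\<lambda>n. jac_sum (fps_const s * fps_X ^ \<alpha>) (fps_const s * fps_X ^ \<beta>)
      (\<lambda>j. fps_const 1) (n + n) n) \<longlonglongrightarrow> qpoch s (\<alpha> + \<beta>) \<alpha> * qpoch s (\<alpha> + \<beta>) \<beta>"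
    by (simp only:)
  have "\<alpha> + \<beta> > 0" using assms(2) by simp
  from jacobi_limit[where v = "\<lambda>_. 1", OF s this lim] show ?thesis
    unfolding mult_1_left .
qed

text \<open>Jacobi's identity in two-sided form: the terms at \<open>k\<close> and
  \<open>-1 - k\<close> share an exponent and add up to the usual weight 2 k + 1. Taking \<beta> = 0
  makes the second argument -1, where the triple product vanishes and its derivative gives the
  cube.\<close>

lemma euler_cube: "qpoch (- 1) 1 1 ^ 3 = gser UNIV (\<lambda>k. k * sgn_pow (- 1) k) (jac_exp 1 0)"
proof -
  let ?P = "qpoch_fin (- 1) 1 1"
  have "jac_sum (fps_const (- 1) * fps_X ^ 1) (fps_const (- 1) * fps_X ^ 0) (\<lambda>j. fps_const j)
      (Suc n + Suc n) (Suc n) = ?P (Suc n) * ?P n" for n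
  proof -
    have c: "fps_const = (of_int :: int \<Rightarrow> int fps)" by (rule ext) (metis fps_of_int of_int_eq_id id_apply)
    have 1: "(\<Prod>i<m. 1 + (- fps_X) * (- (- fps_X)) ^ i) = ?P m" for m
      unfolding qpoch_fin_def by (intro prod.cong) (simp_all flip: fps_const_neg)
    have 2: "(\<Prod>i<m. 1 - (- (- fps_X)) ^ Suc i) = ?P m" for m
      unfolding qpoch_fin_def by (intro prod.cong) (simp_all flip: fps_const_neg)
    have "jac_sum (- fps_X) (- 1) of_int (Suc n + Suc n) (Suc n) = ?P (Suc n) * ?P n"
      unfolding finite_jacobi_cube 1 2 ..
    then show ?thesis by (simp add: c)
  qed
  moreover have "(\<lambda>n. ?P (Suc n) * ?P n) \<longlonglongrightarrow> qpoch (- 1) 1 1 * qpoch (- 1) 1 1"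
    by (intro tendsto_mult_fps LIMSEQ_Suc qpoch_tendsto) simp_all
  ultimately have "(\<lambda>n. jac_sum (fps_const (- 1) * fps_X ^ 1) (fps_const (- 1) * fps_X ^ 0)
      (\<lambda>j. fps_const j) (Suc n + Suc n) (Suc n)) \<longlonglongrightarrow> qpoch (- 1) 1 1 * qpoch (- 1) 1 1"
    by (simp only:)
  from LIMSEQ_imp_Suc[OF this]
  have lim: "(\<lambda>n. jac_sum (fps_const (- 1) * fps_X ^ 1) (fps_const (- 1) * fps_X ^ 0)
      (\<lambda>j. fps_const j) (n + n) n) \<longlonglongrightarrow> qpoch (- 1) 1 1 * qpoch (- 1) 1 1" .
  have "(1::nat) + 0 > 0" by simp
  from jacobi_limit[where v = "\<lambda>j. j", OF _ this lim]
  have "qpoch (- 1) (1 + 0) (1 + 0) * (qpoch (- 1) 1 1 * qpoch (- 1) 1 1) =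
      gser UNIV (\<lambda>j. j * sgn_pow (- 1) j) (jac_exp 1 0)" by blast
  then show ?thesis by (simp only: add_0_right power3_eq_cube mult.assoc)
qed

text \<open>\<open>jacobi_triple_product\<close> asks for positive exponents, so the limit is taken
  anew with \<beta> = 0. The factor 2 is 1 + q^0.\<close>

lemma psi_product: "gser UNIV (\<lambda>_. 1) (jac_exp 2 0) = 2 * (qpoch (- 1) 2 2 * qpoch 1 2 2 ^ 2)"
proof -
  let ?P = "qpoch_fin 1 2 2"
  have e: "2 * Suc i + 0 = 2 * i + 2" for i :: nat by simp
  have z: "qpoch_fin 1 2 0 (Suc n) = 2 * ?P n" for n
    unfolding qpoch_fin_def prod.lessThan_Suc_shift o_def e by (simp only: mult_0_right) simp
  have ab: "(fps_const 1 * fps_X ^ 2) * (fps_const 1 * fps_X ^ 0) = (fps_X :: int fps) ^ 2" by simp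
  have "jac_sum (fps_const 1 * fps_X ^ 2) (fps_const 1 * fps_X ^ 0) (\<lambda>j. fps_const 1)
      (Suc n + Suc n) (Suc n) = ?P (Suc n) * (2 * ?P n)" for n
    using finite_jacobi_triple_product[of "fps_const 1 * fps_X ^ 2 :: int fps"
        "fps_const 1 * fps_X ^ 0" "Suc n" "Suc n"]
    unfolding ab prod_eq_qpoch_fin z unfolding fps_const_1_eq_1 .
  moreover have "(\<lambda>n. ?P (Suc n) * (2 * ?P n)) \<longlonglongrightarrow> qpoch 1 2 2 * (2 * qpoch 1 2 2)"
    by (rule tendsto_mult_fps[OF LIMSEQ_Suc[OF qpoch_tendsto] tendsto_mult_fps[OF tendsto_const qpoch_tendsto]])
      simp_all
  ultimately have "(\<lambda>n. jac_sum (fps_const 1 * fps_X ^ 2) (fps_const 1 * fps_X ^ 0)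
      (\<lambda>j. fps_const 1) (Suc n + Suc n) (Suc n)) \<longlonglongrightarrow> qpoch 1 2 2 * (2 * qpoch 1 2 2)"
    by (simp only:)
  from LIMSEQ_imp_Suc[OF this]
  have lim: "(\<lambda>n. jac_sum (fps_const 1 * fps_X ^ 2) (fps_const 1 * fps_X ^ 0)
      (\<lambda>j. fps_const 1) (n + n) n) \<longlonglongrightarrow> qpoch 1 2 2 * (2 * qpoch 1 2 2)" .
  have "(2::nat) + 0 > 0" by simp
  from jacobi_limit[where v = "\<lambda>_. 1", OF _ this lim]
  have "qpoch (- 1) (2 + 0) (2 + 0) * (qpoch 1 2 2 * (2 * qpoch 1 2 2)) =
      gser UNIV (\<lambda>j. 1 * sgn_pow 1 j) (jac_exp 2 0)" by blast
  moreover have "1 * sgn_pow 1 j = 1" for j by (simp add: sgn_pow_def)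
  ultimately have "gser UNIV (\<lambda>_. 1) (jac_exp 2 0) =
      qpoch (- 1) 2 2 * (qpoch 1 2 2 * (2 * qpoch 1 2 2))"
    by (simp only: add_0_right)
  then show ?thesis by (simp only: power2_eq_square mult_ac)
qed

section \<open>The particular theta series and their products\<close>

definition theta :: "int fps" where
  "theta = gser UNIV (sgn_pow (- 1)) (\<lambda>x. x * x)"

definition theta_pos :: "int fps" where
  "theta_pos = gser UNIV (\<lambda>_. 1) (\<lambda>x. x * x)"

text \<open>Generalized pentagonal numbers. The relation 24 \<open>pent t\<close> + 1 = (6 t + 1)^2
  is the source of the index 24 N + 1.\<close>

definition pent :: "int \<Rightarrow> int" where
  "pent t = t * (3 * t + 1) div 2"

lemma two_pent: "2 * pent t = t * (3 * t + 1)"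
  unfolding pent_def by simp

lemma jac_exp_1_1: "jac_exp 1 1 = (\<lambda>x. x * x)"
proof
  fix x
  have "2 * jac_exp 1 1 x = 2 * (x * x)"
    unfolding jac_exp_def distrib_left using two_tri[of x] two_tri'[of x] by (simp add: algebra_simps)
  then show "jac_exp 1 1 x = x * x" by simp
qed

lemma jac_exp_2_1: "jac_exp 2 1 = pent"
proof
  fix x
  have "2 * jac_exp 2 1 x = 2 * pent x"
    unfolding two_pent jac_exp_def distrib_left using two_tri[of x] two_tri'[of x] by (simp add: algebra_simps)
  then show "jac_exp 2 1 x = pent x" by simp
qed

lemma proper_square: "proper UNIV (\<lambda>x::int. x * x)"
  using proper_jac_exp[of 1 1] unfolding jac_exp_1_1 by simp

lemma proper_pent: "proper UNIV pent"
  using proper_jac_exp[of 2 1] unfolding jac_exp_2_1 by simp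

lemma theta_product: "theta = qpoch (- 1) 2 2 * qpoch (- 1) 2 1 ^ 2"
  using jacobi_triple_product[of "- 1" 1 1]
  unfolding jac_exp_1_1 one_add_one theta_def [symmetric] by (simp add: power2_eq_square)

lemma theta_pos_product: "theta_pos = qpoch (- 1) 2 2 * qpoch 1 2 1 ^ 2"
proof -
  have "sgn_pow 1 = (\<lambda>_. 1)" by (rule ext) (simp add: sgn_pow_def)
  with jacobi_triple_product[of 1 1 1] show ?thesis
    unfolding jac_exp_1_1 one_add_one theta_pos_def by (simp add: power2_eq_square)
qed

lemma pentagonal: "qpoch (- 1) 1 1 = gser UNIV (sgn_pow (- 1)) pent"
proof -
  have e: "3 * 1 = (3::nat)" "1 + 1 = (2::nat)" "2 * 1 + 1 = (3::nat)" "2 + 1 = (3::nat)"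
    by simp_all
  have "qpoch (- 1) 1 1 = qpoch (- 1) 3 1 * qpoch (- 1) 3 2 * qpoch (- 1) 3 3"
    using qpoch_split_3[of 1 1 "- 1"] unfolding e by simp
  moreover have "qpoch (- 1) 3 3 * (qpoch (- 1) 3 2 * qpoch (- 1) 3 1) = gser UNIV (sgn_pow (- 1)) pent"
    using jacobi_triple_product[of "- 1" 2 1] unfolding jac_exp_2_1 e by simp
  ultimately show ?thesis by (simp only: mult_ac)
qed

section \<open>Theta identities\<close>

lemma euler_even_odd: "qpoch (- 1) 1 1 = qpoch (- 1) 2 1 * qpoch (- 1) 2 2"
  using qpoch_split_2[of 1 1 "- 1"] unfolding one_add_one mult_1_right by simp

text \<open>Euler's theorem on distinct and odd parts. It also identifies
  \<open>qpoch 1 2 1 * qpoch 1 2 2\<close> with the quotient of \<open>qpoch (- 1) 1 1\<close> by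
  \<open>theta\<close>.\<close>

lemma euler_distinct_odd: "qpoch 1 2 1 * qpoch 1 2 2 * qpoch (- 1) 2 1 = 1"
proof -
  have "qpoch 1 1 1 = qpoch 1 2 1 * qpoch 1 2 2"
    using qpoch_split_2[of 1 1 1] unfolding one_add_one mult_1_right by simp
  moreover have "qpoch 1 1 1 * qpoch (- 1) 1 1 = qpoch (- 1) 2 2"
    using qpoch_mult_minus[of 1 1] unfolding mult_1_right by simp
  ultimately have "qpoch 1 2 1 * qpoch 1 2 2 * qpoch (- 1) 2 1 * qpoch (- 1) 2 2 = 1 * qpoch (- 1) 2 2"
    by (simp only: euler_even_odd mult_1_left mult.assoc)
  then show ?thesis unfolding mult_right_cancel[OF qpoch_nonzero] .
qed

text \<open>Gauss's quotient (q; q) / (-q; q) for \<open>theta\<close> is moved to q^2, and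
  \<open>euler_distinct_odd\<close> clears the denominator.\<close>

lemma theta_compose_sq:
  "(theta oo fps_X ^ 2) = qpoch (- 1) 2 2 * qpoch 1 2 1 * qpoch (- 1) 2 1"
proof -
  have X0: "((fps_X :: int fps) ^ 2) $ 0 = 0" by (simp add: fps_X_power_nth)
  have c: "(qpoch 1 1 1 oo fps_X ^ 2) = qpoch 1 2 2" "(qpoch (- 1) 1 1 oo fps_X ^ 2) = qpoch (- 1) 2 2"
    using qpoch_compose[of 1 1 2] unfolding mult_1_right by simp_all
  have F: "qpoch 1 1 1 = qpoch 1 2 1 * qpoch 1 2 2"
    using qpoch_split_2[of 1 1 1] unfolding one_add_one mult_1_right by simp
  have "theta * qpoch 1 1 1 = qpoch (- 1) 1 1 * (qpoch 1 2 1 * qpoch 1 2 2 * qpoch (- 1) 2 1)"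
    unfolding theta_product F euler_even_odd power2_eq_square by (simp only: mult_ac)
  then have "theta * qpoch 1 1 1 = qpoch (- 1) 1 1"
    unfolding euler_distinct_odd by simp
  then have "(theta oo fps_X ^ 2) * qpoch 1 2 2 = qpoch (- 1) 2 2"
    unfolding c [symmetric] fps_compose_mult_distrib[OF X0, symmetric] by (simp only:)
  then have "(theta oo fps_X ^ 2) * qpoch 1 2 2 * (qpoch 1 2 1 * qpoch (- 1) 2 1) =
      qpoch (- 1) 2 2 * (qpoch 1 2 1 * qpoch (- 1) 2 1)" by (rule arg_cong)
  moreover have "(theta oo fps_X ^ 2) * qpoch 1 2 2 * (qpoch 1 2 1 * qpoch (- 1) 2 1) =
      (theta oo fps_X ^ 2) * (qpoch 1 2 1 * qpoch 1 2 2 * qpoch (- 1) 2 1)"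
    by (simp only: mult_ac)
  ultimately show ?thesis unfolding euler_distinct_odd by (simp only: mult_1_right mult.assoc)
qed

lemma euler_compose_uminus: "(qpoch (- 1) 1 1 oo (- fps_X)) = qpoch 1 2 1 * qpoch (- 1) 2 2"
proof -
  have "(- fps_X :: int fps) $ 0 = 0" by simp
  then show ?thesis
    unfolding euler_even_odd by (simp only: fps_compose_mult_distrib
        qpoch_compose_uminus_odd[OF odd_one] qpoch_compose_uminus_even[OF dvd_refl zero_less_numeral] minus_minus)
qed

lemma sgn_pow_minus_one:
  "sgn_pow (- 1) (x + y) = sgn_pow (- 1) x * sgn_pow (- 1) y"
  "sgn_pow (- 1) (x - y) = sgn_pow (- 1) x * sgn_pow (- 1) y"
  "sgn_pow (- 1) (- x) = sgn_pow (- 1) x"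
  "sgn_pow (- 1) x * sgn_pow (- 1) x = 1"
  "sgn_pow (- 1) 1 = - 1" "sgn_pow (- 1) (2 * x) = 1"
  by (auto simp: sgn_pow_def)

lemma theta_compose_uminus: "(theta oo (- fps_X)) = theta_pos"
  unfolding theta_def theta_pos_def gser_compose_uminus
  by (rule gser_cong) (auto simp: sgn_pow_def)

section \<open>The series \<open>T\<close> as a product\<close>

definition lin_theta :: "int fps" where
  "lin_theta = gser UNIV (\<lambda>t. 6 * t + 1) pent"

lemma two_jac_exp_1_0: "2 * jac_exp 1 0 k = k * (k + 1)"
  unfolding jac_exp_def by simp

text \<open>In the double series for \<open>E\<^sup>3 theta\<close> put \<open>s = k + 2 m\<close> and complete the square in \<open>m\<close>:
  the classes \<open>s \<equiv> 0, 2 (mod 3)\<close> each contribute a multiple of \<open>E(q\<^sup>2)\<close>, and \<open>s \<equiv> 1\<close> cancels.\<close>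

lemma lin_theta_times_euler: "lin_theta * qpoch (- 1) 2 2 = qpoch (- 1) 1 1 ^ 3 * theta"
proof -
  define sg where "sg = sgn_pow (- 1)"
  define tri where "tri = jac_exp 1 0"
  let ?U = "UNIV :: (int \<times> int) set"
  let ?w = "\<lambda>(k, m). (k + 2 * m) * (sg k * sg m)" and ?e = "\<lambda>(k, m). tri k + m * m"
  let ?f = "\<lambda>(t, m). pent t + 2 * pent m"
  have tri: "2 * tri k = k * (k + 1)" for k unfolding tri_def by (rule two_jac_exp_1_0)
  have ptri: "proper UNIV tri" unfolding tri_def by (rule proper_jac_exp) simp
  have p: "proper ?U ?e" using proper_times[OF ptri proper_square] by simp
  have sg: "sg (x + y) = sg x * sg y" "sg (x - y) = sg x * sg y" "sg (- x) = sg x"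
    "sg x * sg x = 1" "sg 1 = - 1" "sg (2 * x) = 1" for x y
    unfolding sg_def by (rule sgn_pow_minus_one)+
  have sg': "sg x * (sg x * z) = z" for x z using sg(4)[of x] by (simp flip: mult.assoc)
  have euler2: "qpoch (- 1) 2 2 = gser UNIV sg (\<lambda>m. 2 * pent m)"
    using qpoch_compose[of 1 1 2 "- 1"] gser_compose_X_power[of 2 UNIV pent sg]
    unfolding mult_1_right pentagonal sg_def by (simp add: proper_pent)
  have ppent2: "proper UNIV (\<lambda>m. 2 * pent m)"
  proof (rule properI_abs)
    fix m :: int
    have "\<bar>m\<bar> \<le> m * m" using self_le_power[of "\<bar>m\<bar>" 2] by (cases "m = 0") (auto simp: power2_eq_square)
    then have "0 \<le> m * (3 * m + 1)" "\<bar>m\<bar> - 1 \<le> m * (3 * m + 1)"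
      by (simp_all add: algebra_simps abs_if split: if_splits)
    then show "\<bar>m\<bar> - 1 \<le> 2 * pent m" "0 \<le> 2 * pent m" by (simp_all only: two_pent)
  qed
  define A where "A r = {x. (fst x + 2 * snd x) mod 3 = r}" for r :: int
  have U: "?U = A 0 \<union> A 1 \<union> A 2" by (auto simp: A_def)
  have split: "gser ?U ?w ?e = gser (A 0) ?w ?e + gser (A 1) ?w ?e + gser (A 2) ?w ?e"
  proof -
    have "proper (A 0 \<union> A 1 \<union> A 2) ?e" "proper (A 0 \<union> A 1) ?e"
      by (rule proper_subset[OF p], simp)+
    moreover have "(A 0 \<union> A 1) \<inter> A 2 = {}" "A 0 \<inter> A 1 = {}" by (auto simp: A_def)
    ultimately show ?thesis unfolding U by (simp only: gser_Un)
  qed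
  \<comment> \<open>For fixed s = k + 2 m the exponent is 3 m^2 - (2 s + 1) m + s (s + 1) / 2,
    centred at m = (2 s + 1) / 6. For s = 3 t the centre is t + 1/6, so m is measured from
    t.\<close>
  have A0: "gser (A 0) ?w ?e = gser ?U (\<lambda>(t, m). 3 * t * sg m) ?f"
  proof (rule gser_reindex[symmetric, where g = "\<lambda>(t, m). (t + 2 * m, t - m)" and
        h = "\<lambda>(k, m). ((k + 2 * m) div 3, (k + 2 * m) div 3 - m)"])
    fix x :: "int \<times> int" assume "x \<in> UNIV"
    obtain t m where x: "x = (t, m)" by (cases x)
    show "(case x of (t, m) \<Rightarrow> (t + 2 * m, t - m)) \<in> A 0 \<and>
        (case (case x of (t, m) \<Rightarrow> (t + 2 * m, t - m)) of (k, m) \<Rightarrow> ((k + 2 * m) div 3, (k + 2 * m) div 3 - m)) = x"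
      unfolding x by (simp add: A_def)
    have "2 * (tri (t + 2 * m) + (t - m) * (t - m)) = 2 * (pent t + 2 * pent m)"
      unfolding distrib_left mult.left_commute[of 2 2] tri two_pent by (simp add: algebra_simps)
    then have e: "tri (t + 2 * m) + (t - m) * (t - m) = pent t + 2 * pent m" by simp
    have w: "(t + 2 * m + 2 * (t - m)) * (sg (t + 2 * m) * sg (t - m)) = 3 * t * sg m"
      unfolding sg by (simp add: sg' mult.assoc)
    show "(case x of (t, m) \<Rightarrow> 3 * t * sg m) = ?w (case x of (t, m) \<Rightarrow> (t + 2 * m, t - m)) \<and>
        ?f x = ?e (case x of (t, m) \<Rightarrow> (t + 2 * m, t - m))"
      unfolding x prod.case e w by simp
  next
    fix y assume "y \<in> A 0"
    then obtain k m t where y: "y = (k, m)" "k + 2 * m = 3 * t"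
      by (cases y) (auto simp: A_def elim!: dvdE simp flip: dvd_eq_mod_eq_0)
    have "k = 3 * t - 2 * m" using y(2) by simp
    then show "(case y of (k, m) \<Rightarrow> ((k + 2 * m) div 3, (k + 2 * m) div 3 - m)) \<in> UNIV \<and>
        (case (case y of (k, m) \<Rightarrow> ((k + 2 * m) div 3, (k + 2 * m) div 3 - m)) of (t, m) \<Rightarrow> (t + 2 * m, t - m)) = y"
      by (simp add: y(1))
  qed
  \<comment> \<open>Here s = -3 t - 1 and the centre is -t - 1/6. The two minus signs in the weight
    cancel, leaving 3 t + 1.\<close>
  have A2: "gser (A 2) ?w ?e = gser ?U (\<lambda>(t, m). (3 * t + 1) * sg m) ?f"
  proof (rule gser_reindex[symmetric, where g = "\<lambda>(t, m). (- t - 1 - 2 * m, m - t)" and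
        h = "\<lambda>(k, m). (- ((k + 2 * m + 1) div 3), m - (k + 2 * m + 1) div 3)"])
    fix x :: "int \<times> int" assume "x \<in> UNIV"
    obtain t m where x: "x = (t, m)" by (cases x)
    have "(- t - 1 - 2 * m + 2 * (m - t)) mod 3 = 2" by presburger
    moreover have "(- t - 1 - 2 * m + 2 * (m - t) + 1) div 3 = - t" by presburger
    ultimately show "(case x of (t, m) \<Rightarrow> (- t - 1 - 2 * m, m - t)) \<in> A 2 \<and>
        (case (case x of (t, m) \<Rightarrow> (- t - 1 - 2 * m, m - t)) of (k, m) \<Rightarrow>
          (- ((k + 2 * m + 1) div 3), m - (k + 2 * m + 1) div 3)) = x"
      unfolding x A_def by (simp only: prod.case fst_conv snd_conv mem_Collect_eq) simp
    have "2 * (tri (- t - 1 - 2 * m) + (m - t) * (m - t)) = 2 * (pent t + 2 * pent m)"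
      unfolding distrib_left mult.left_commute[of 2 2] tri two_pent by (simp add: algebra_simps)
    then have e: "tri (- t - 1 - 2 * m) + (m - t) * (m - t) = pent t + 2 * pent m" by simp
    have w: "(- t - 1 - 2 * m + 2 * (m - t)) * (sg (- t - 1 - 2 * m) * sg (m - t)) = (3 * t + 1) * sg m"
      unfolding sg by (simp add: sg' sg(4) algebra_simps)
    show "(case x of (t, m) \<Rightarrow> (3 * t + 1) * sg m) = ?w (case x of (t, m) \<Rightarrow> (- t - 1 - 2 * m, m - t)) \<and>
        ?f x = ?e (case x of (t, m) \<Rightarrow> (- t - 1 - 2 * m, m - t))"
      unfolding x prod.case e w by simp
  next
    fix y assume "y \<in> A 2"
    then have "(fst y + 2 * snd y + 1) mod 3 = 0" unfolding A_def mem_Collect_eq by presburger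
    then obtain k m t where y: "y = (k, m)" "k + 2 * m + 1 = 3 * t"
      by (cases y) (auto elim!: dvdE simp flip: dvd_eq_mod_eq_0)
    have "k = 3 * t - 1 - 2 * m" using y(2) by simp
    then show "(case y of (k, m) \<Rightarrow> (- ((k + 2 * m + 1) div 3), m - (k + 2 * m + 1) div 3)) \<in> UNIV \<and>
        (case (case y of (k, m) \<Rightarrow> (- ((k + 2 * m + 1) div 3), m - (k + 2 * m + 1) div 3)) of
          (t, m) \<Rightarrow> (- t - 1 - 2 * m, m - t)) = y"
      by (simp add: y(1))
  qed
  \<comment> \<open>For s = 3 t + 1 the centre t + 1/2 is a half-integer. The reflection m -> 2 t +
    1 - m keeps \<open>s\<close> and the exponent and reverses the parity of m, hence the
    sign.\<close>
  have A1: "gser (A 1) ?w ?e = 0"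
  proof (rule gser_odd_involution[where h =
        "\<lambda>(k, m). (k + 4 * m - 2 - 4 * ((k + 2 * m - 1) div 3), 1 - m + 2 * ((k + 2 * m - 1) div 3))"])
    fix x assume "x \<in> A 1"
    then have "(fst x + 2 * snd x - 1) mod 3 = 0" unfolding A_def mem_Collect_eq by presburger
    then obtain k m t where y: "x = (k, m)" "k + 2 * m - 1 = 3 * t"
      by (cases x) (auto elim!: dvdE simp flip: dvd_eq_mod_eq_0)
    have k: "k = 3 * t + 1 - 2 * m" using y(2) by simp
    have h: "(case x of (k, m) \<Rightarrow> (k + 4 * m - 2 - 4 * ((k + 2 * m - 1) div 3), 1 - m + 2 * ((k + 2 * m - 1) div 3)))
        = (3 * t + 1 - 2 * (1 - m + 2 * t), 1 - m + 2 * t)"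
      unfolding y(1) prod.case y(2) by (simp add: k)
    have x: "x = (3 * t + 1 - 2 * m, m)" using y(1) k by simp
    show "(case x of (k, m) \<Rightarrow> (k + 4 * m - 2 - 4 * ((k + 2 * m - 1) div 3), 1 - m + 2 * ((k + 2 * m - 1) div 3)))
        \<in> A 1 \<and> (case (case x of (k, m) \<Rightarrow> (k + 4 * m - 2 - 4 * ((k + 2 * m - 1) div 3), 1 - m + 2 * ((k + 2 * m - 1) div 3)))
        of (k, m) \<Rightarrow> (k + 4 * m - 2 - 4 * ((k + 2 * m - 1) div 3), 1 - m + 2 * ((k + 2 * m - 1) div 3))) = x"
      unfolding h unfolding x by (simp add: A_def)
    have "sg (3 * t + 1 - 2 * (1 - m + 2 * t)) * sg (1 - m + 2 * t) = - (sg (3 * t + 1 - 2 * m) * sg m)"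
      unfolding sg by simp
    then show "?w (case x of (k, m) \<Rightarrow> (k + 4 * m - 2 - 4 * ((k + 2 * m - 1) div 3), 1 - m + 2 * ((k + 2 * m - 1) div 3)))
        = - ?w x"
      unfolding h unfolding x by simp
    have "2 * (tri (3 * t + 1 - 2 * (1 - m + 2 * t)) + (1 - m + 2 * t) * (1 - m + 2 * t)) =
        2 * (tri (3 * t + 1 - 2 * m) + m * m)"
      unfolding distrib_left tri by (simp add: algebra_simps)
    then show "?e (case x of (k, m) \<Rightarrow> (k + 4 * m - 2 - 4 * ((k + 2 * m - 1) div 3), 1 - m + 2 * ((k + 2 * m - 1) div 3)))
        = ?e x"
      unfolding h unfolding x by simp
  qed
  \<comment> \<open>Trading the weight \<open>k\<close> for \<open>s = k + 2 m\<close> is free,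
    since the added part is odd in \<open>m\<close>.\<close>
  have Z: "gser ?U (\<lambda>(k, m). 2 * m * (sg k * sg m)) ?e = 0"
    by (rule gser_odd_involution[where h = "\<lambda>(k, m). (k, - m)"]) (auto simp: sg(3))
  have "qpoch (- 1) 1 1 ^ 3 * theta = gser ?U (\<lambda>(k, m). k * sg k * sg m) ?e"
    unfolding euler_cube theta_def
    using gser_mult[OF ptri proper_square, of "\<lambda>k. k * sg k" sg] by (simp add: tri_def sg_def)
  also have "\<dots> = gser ?U ?w ?e - gser ?U (\<lambda>(k, m). 2 * m * (sg k * sg m)) ?e"
    unfolding gser_diff by (rule gser_cong) (auto simp: algebra_simps)
  also have "\<dots> = gser ?U (\<lambda>(t, m). (6 * t + 1) * sg m) ?f"
    unfolding Z split A0 A1 A2 add_0_right diff_0_right gser_add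
    by (rule gser_cong) (auto simp: algebra_simps)
  also have "\<dots> = lin_theta * qpoch (- 1) 2 2"
    unfolding lin_theta_def euler2 using gser_mult[OF proper_pent ppent2, of "\<lambda>t. 6 * t + 1" sg] by simp
  finally show ?thesis by (rule sym)
qed

lemma lin_theta_eq: "lin_theta = qpoch (- 1) 1 1 * theta ^ 2"
proof -
  have "lin_theta * qpoch (- 1) 2 2 = qpoch (- 1) 1 1 * theta ^ 2 * qpoch (- 1) 2 2"
    unfolding lin_theta_times_euler theta_product euler_even_odd
    by (simp add: power2_eq_square power3_eq_cube mult_ac)
  then show ?thesis unfolding mult_right_cancel[OF qpoch_nonzero] .
qed

section \<open>Jacobi's four-square argument\<close>

definition psi2 :: "int fps" where
  "psi2 = gser UNIV (\<lambda>_. 1) (\<lambda>u. u * u + u)"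

text \<open>The series is 2 psi(q^2) for Ramanujan's psi: \<open>u\<close> and \<open>-1 - u\<close>
  give the same exponent, whence the factor 2.\<close>

lemma psi2_product: "psi2 = 2 * (qpoch (- 1) 2 2 * qpoch 1 2 2 ^ 2)"
proof -
  have "jac_exp 2 0 = (\<lambda>u. u * u + u)"
    by (rule ext) (simp add: jac_exp_def algebra_simps)
  with psi_product show ?thesis by (simp add: psi2_def)
qed

text \<open>Squaring Jacobi's series for \<open>2 E\<^sup>3\<close> and substituting \<open>r = u + v\<close>, \<open>s = u - v\<close>
  (after reducing to even \<open>r + s\<close> by \<open>s \<mapsto> -1 - s\<close>).\<close>

lemma euler_sixth_power:
  "2 * qpoch (- 1) 1 1 ^ 6 =
    psi2 * theta_pos + 4 * (fps_XD psi2 * theta_pos - psi2 * fps_XD theta_pos)"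
proof -
  define sg where "sg = sgn_pow (- 1)"
  define tri where "tri = jac_exp 1 0"
  let ?U = "UNIV :: (int \<times> int) set"
  let ?w = "\<lambda>(r, s). (2 * r + 1) * sg r * ((2 * s + 1) * sg s)" and ?e = "\<lambda>(r, s). tri r + tri s"
  have tri: "2 * tri k = k * (k + 1)" for k unfolding tri_def by (rule two_jac_exp_1_0)
  have tri_refl: "tri (- 1 - k) = tri k" for k
    using tri[of k] tri[of "- 1 - k"] by (simp add: algebra_simps)
  have ptri: "proper UNIV tri" unfolding tri_def by (rule proper_jac_exp) simp
  have p: "proper ?U ?e" using proper_times[OF ptri ptri] by simp
  have ppsi: "proper UNIV (\<lambda>u::int. u * u + u)"
  proof -
    have "jac_exp 2 0 = (\<lambda>u. u * u + u)"
      by (rule ext) (simp add: jac_exp_def algebra_simps)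
    then show ?thesis using proper_jac_exp[of 2 0] by simp
  qed
  have sg: "sg (x + y) = sg x * sg y" "sg (x - y) = sg x * sg y" "sg (- x) = sg x"
    "sg x * sg x = 1" "sg (- 1) = - 1" "sg 1 = - 1" for x y
    unfolding sg_def by (auto simp: sgn_pow_def)
  \<comment> \<open>This zero is added to change the weight 2 r of twice the cube into 2 r + 1,
    which is odd under r -> -1 - r.\<close>
  have "gser UNIV sg tri = 0"
    by (rule gser_odd_involution[where h = "\<lambda>k. - 1 - k"]) (simp_all add: tri_refl sg)
  then have "2 * qpoch (- 1) 1 1 ^ 3 = gser UNIV (\<lambda>r. 2 * (r * sg r)) tri + gser UNIV sg tri"
    unfolding euler_cube gser_numeral tri_def sg_def by simp
  also have "\<dots> = gser UNIV (\<lambda>r. (2 * r + 1) * sg r) tri"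
    unfolding gser_add by (simp add: algebra_simps)
  finally have cube: "2 * qpoch (- 1) 1 1 ^ 3 = gser UNIV (\<lambda>r. (2 * r + 1) * sg r) tri" .
  have pow: "qpoch (- 1) 1 1 ^ 6 = qpoch (- 1) 1 1 ^ 3 * qpoch (- 1) 1 1 ^ 3"
    unfolding power_add [symmetric] by (rule arg_cong) simp
  have "4 * qpoch (- 1) 1 1 ^ 6 = (2 * qpoch (- 1) 1 1 ^ 3) * (2 * qpoch (- 1) 1 1 ^ 3)"
    unfolding pow by (simp only: mult_ac) simp
  also have "\<dots> = gser ?U ?w ?e"
    unfolding cube gser_mult[OF ptri ptri] by simp
  finally have sixth: "4 * qpoch (- 1) 1 1 ^ 6 = gser ?U ?w ?e" .
  define A where "A b = {x::int \<times> int. even (fst x + snd x) = b}" for b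
  have U: "?U = A True \<union> A False" "A True \<inter> A False = {}" by (auto simp: A_def)
  have split: "gser ?U ?w ?e = gser (A True) ?w ?e + gser (A False) ?w ?e"
    unfolding U(1) by (rule gser_Un) (use p U in simp_all)
  have "gser (A False) ?w ?e = gser (A True) ?w ?e"
    by (rule gser_reindex[where g = "\<lambda>(r, s). (r, - 1 - s)" and h = "\<lambda>(r, s). (r, - 1 - s)"])
      (auto simp: A_def tri_refl sg algebra_simps)
  \<comment> \<open>The weight becomes (2 u + 1)^2 - (2 v)^2 = 1 + 4 (u^2 + u) - 4 v^2. It is affine
    in the two partial exponents, and this is how \<open>fps_XD\<close> arises.\<close>
  moreover have "gser (A True) ?w ?e =
      gser ?U (\<lambda>(u, v). 1 + 4 * (u * u + u) - 4 * (v * v)) (\<lambda>(u, v). (u * u + u) + v * v)"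
  proof (rule gser_reindex[symmetric, where g = "\<lambda>(u, v). (u + v, u - v)" and
        h = "\<lambda>(r, s). ((r + s) div 2, (r - s) div 2)"])
    fix x :: "int \<times> int" assume "x \<in> UNIV"
    obtain u v where x: "x = (u, v)" by (cases x)
    show "(case x of (u, v) \<Rightarrow> (u + v, u - v)) \<in> A True \<and>
        (case (case x of (u, v) \<Rightarrow> (u + v, u - v)) of (r, s) \<Rightarrow> ((r + s) div 2, (r - s) div 2)) = x"
      unfolding x by (simp add: A_def)
    have "2 * (tri (u + v) + tri (u - v)) = 2 * ((u * u + u) + v * v)"
      unfolding distrib_left tri by (simp add: algebra_simps)
    then have e: "tri (u + v) + tri (u - v) = (u * u + u) + v * v" by simp
    have "sg (u + v) * sg (u - v) = (sg u * sg u) * (sg v * sg v)"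
      unfolding sg(1,2) by (simp only: mult_ac)
    then have one: "sg (u + v) * sg (u - v) = 1" unfolding sg(4) by simp
    have "(2 * (u + v) + 1) * sg (u + v) * ((2 * (u - v) + 1) * sg (u - v)) =
        (2 * (u + v) + 1) * (2 * (u - v) + 1) * (sg (u + v) * sg (u - v))"
      by (simp only: mult_ac)
    then have w: "(2 * (u + v) + 1) * sg (u + v) * ((2 * (u - v) + 1) * sg (u - v)) =
        (2 * (u + v) + 1) * (2 * (u - v) + 1)"
      unfolding one by simp
    show "(case x of (u, v) \<Rightarrow> 1 + 4 * (u * u + u) - 4 * (v * v)) = ?w (case x of (u, v) \<Rightarrow> (u + v, u - v)) \<and>
        (case x of (u, v) \<Rightarrow> (u * u + u) + v * v) = ?e (case x of (u, v) \<Rightarrow> (u + v, u - v))"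
      unfolding x prod.case e w by (simp add: algebra_simps)
  next
    fix y assume "y \<in> A True"
    obtain r s where y: "y = (r, s)" by (cases y)
    with \<open>y \<in> A True\<close> have "even (r + s)" "even (r - s)" by (auto simp: A_def)
    then obtain u v where uv: "r + s = 2 * u" "r - s = 2 * v" by (metis evenE)
    then have "r = u + v" "s = u - v" by linarith+
    with uv show "(case y of (r, s) \<Rightarrow> ((r + s) div 2, (r - s) div 2)) \<in> UNIV \<and>
        (case (case y of (r, s) \<Rightarrow> ((r + s) div 2, (r - s) div 2)) of (u, v) \<Rightarrow> (u + v, u - v)) = y"
      by (simp add: y)
  qed
  ultimately have "2 * (2 * qpoch (- 1) 1 1 ^ 6) = 2 * gser ?U
      (\<lambda>(u, v). 1 + 4 * (u * u + u) - 4 * (v * v)) (\<lambda>(u, v). (u * u + u) + v * v)"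
    using sixth split by (simp only: mult_2 [of "gser _ _ _"] mult.assoc [symmetric]) simp
  then have "2 * qpoch (- 1) 1 1 ^ 6 =
      gser ?U (\<lambda>(u, v). 1 + 4 * (u * u + u) - 4 * (v * v)) (\<lambda>(u, v). (u * u + u) + v * v)"
    by (simp only: mult_cancel_left) simp
  also have "\<dots> = gser ?U (\<lambda>(u, v). 1 * 1) (\<lambda>(u, v). (u * u + u) + v * v) +
      4 * (gser ?U (\<lambda>(u, v). ((u * u + u) * 1) * 1) (\<lambda>(u, v). (u * u + u) + v * v)
      - gser ?U (\<lambda>(u, v). 1 * (v * v * 1)) (\<lambda>(u, v). (u * u + u) + v * v))"
    unfolding gser_diff gser_numeral gser_add by (rule gser_cong) auto
  also have "\<dots> = psi2 * theta_pos + 4 * (fps_XD psi2 * theta_pos - psi2 * fps_XD theta_pos)"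
    unfolding psi2_def theta_pos_def fps_XD_gser gser_mult[OF ppsi proper_square] by simp
  finally show ?thesis .
qed

lemma fps_XD_mult: "fps_XD (a * b) = fps_XD a * b + a * fps_XD (b :: int fps)"
  by (simp add: fps_XD_def algebra_simps)

lemma fps_XD_two: "fps_XD (2 :: int fps) = 0"
  by (simp add: fps_XD_def)

text \<open>\<open>psi2\<close> and \<open>theta_pos\<close> share the factor
  \<open>qpoch (- 1) 2 2\<close>, whose derivative drops out of the antisymmetric expression in
  \<open>euler_sixth_power\<close>. The remaining squares of \<open>F\<close> and \<open>G\<close>
  leave 2 F G times the expression of \<open>DSOME_gf\<close>, up to sign.\<close>

lemma DSOME_eta_quotient:
  "8 * Abs_fps DSOME = qpoch 1 2 1 * qpoch 1 2 2 - qpoch (- 1) 1 1 * theta ^ 3"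
proof -
  define G F C E where "G = qpoch 1 2 1" and "F = qpoch 1 2 2" and "C = qpoch (- 1) 2 1"
    and "E = qpoch (- 1) 2 2"
  define D where "D = Abs_fps DSOME"
  have D: "D = fps_XD G * F - G * fps_XD F"
    unfolding D_def G_def F_def by (rule DSOME_gf)
  have OFC: "G * F * C = 1" unfolding G_def F_def C_def by (rule euler_distinct_odd)
  have E1: "qpoch (- 1) 1 1 = C * E" unfolding C_def E_def by (rule euler_even_odd)
  have "2 * (C * E) ^ 6 = 2 * (E * F ^ 2) * (E * G ^ 2) + 4 * (fps_XD (2 * (E * F ^ 2)) * (E * G ^ 2)
      - 2 * (E * F ^ 2) * fps_XD (E * G ^ 2))"
    using euler_sixth_power unfolding psi2_product theta_pos_product E1
    unfolding G_def [symmetric] F_def [symmetric] E_def [symmetric] .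
  also have "\<dots> = 2 * (E ^ 2 * (G * F) * (G * F - 8 * D))"
    unfolding D fps_XD_mult power2_eq_square fps_XD_two by (simp add: algebra_simps)
  finally have "(C * E) ^ 6 = E ^ 2 * (G * F) * (G * F - 8 * D)"
    by (simp only: mult_cancel_left) simp
  then have "C * (C * E) ^ 6 = E ^ 2 * (G * F * C) * (G * F - 8 * D)"
    by (simp only: mult_ac)
  then have "E ^ 2 * (C ^ 7 * E ^ 4) = E ^ 2 * (G * F - 8 * D)"
    unfolding OFC by (simp add: power_mult_distrib eval_nat_numeral mult_ac)
  then have "C ^ 7 * E ^ 4 = G * F - 8 * D"
    by (simp add: E_def)
  moreover have "qpoch (- 1) 1 1 * theta ^ 3 = C ^ 7 * E ^ 4"
    unfolding theta_product E1 C_def [symmetric] E_def [symmetric]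
    by (simp add: power_mult_distrib eval_nat_numeral mult_ac)
  ultimately show ?thesis by (simp add: G_def F_def D_def)
qed

section \<open>Reduction modulo 32\<close>

lemma theta_split:
  obtains S M where "theta = 1 + 2 * S" "theta_pos = 1 + 2 * (S + 2 * M)"
    "(theta oo fps_X ^ 2) = 1 + 2 * (S oo fps_X ^ 2)" "\<exists>K. S ^ 2 = (S oo fps_X ^ 2) + 2 * K"
proof -
  define P where "P = {x::int. 0 < x}"
  define S where "S = gser P (sgn_pow (- 1)) (\<lambda>x. x * x)"
  have sp: "gser UNIV w (\<lambda>x. x * x) = fps_const (w 0) + 2 * gser P w (\<lambda>x. x * x)"
    if "\<And>x. w (- x) = w x" for w :: "int \<Rightarrow> int"
  proof -
    define N where "N = {x::int. x < 0}"
    have U: "UNIV = ({0} \<union> P) \<union> N" "({0} \<union> P) \<inter> N = {}" "{0} \<inter> P = {}" by (auto simp: P_def N_def)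
    have "proper ({0} \<union> P \<union> N) (\<lambda>x. x * x)" "proper ({0} \<union> P) (\<lambda>x. x * x)"
      by (rule proper_subset[OF proper_square], simp)+
    then have "gser UNIV w (\<lambda>x. x * x) = gser {0} w (\<lambda>x. x * x) + gser P w (\<lambda>x. x * x) + gser N w (\<lambda>x. x * x)"
      unfolding U(1) by (simp only: gser_Un U(2,3))
    moreover have "gser N w (\<lambda>x. x * x) = gser P w (\<lambda>x. x * x)"
      by (rule gser_reindex[where g = uminus and h = uminus]) (auto simp: P_def N_def that)
    moreover have "gser {0} w (\<lambda>x. x * x) = fps_const (w 0)"
    proof (rule fps_ext)
      have "{i \<in> {0}. i * i = int n} = (if n = 0 then {0} else {})" for n by auto
      then show "gser {0} w (\<lambda>x. x * x) $ n = fps_const (w 0) $ n" for n by (simp add: gser_nth)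
    qed
    ultimately show ?thesis by (simp only: mult_2 add.assoc)
  qed
  have 1: "theta = 1 + 2 * S"
    unfolding theta_def S_def by (subst sp) (simp_all add: sgn_pow_def)
  have 2: "theta_pos = 1 + 2 * gser P (\<lambda>_. 1) (\<lambda>x. x * x)"
    unfolding theta_pos_def by (subst sp) simp_all
  \<comment> \<open>The two theta series differ only at odd \<open>x\<close>, so the
    \<open>M\<close> of the statement is the sum over odd positive \<open>x\<close>, and theta_pos -
    theta = 4 M.\<close>
  have 3: "gser P (\<lambda>_. 1) (\<lambda>x. x * x) = S + 2 * gser P (\<lambda>x. if even x then 0 else 1) (\<lambda>x. x * x)"
    unfolding S_def gser_numeral gser_add by (rule gser_cong) (auto simp: sgn_pow_def)
  have 4: "(1 + 2 * S oo fps_X ^ 2) = 1 + 2 * (S oo fps_X ^ 2)"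
  proof -
    have "((fps_X :: int fps) ^ 2) $ 0 = 0" by (simp add: fps_X_power_nth)
    then show ?thesis
      by (simp only: fps_compose_add_distrib fps_compose_mult_distrib fps_compose_1 numeral_compose)
  qed
  have 5: "\<exists>K. S ^ 2 = (S oo fps_X ^ 2) + 2 * K"
  proof -
    have p: "proper P (\<lambda>x. x * x)" by (rule proper_subset[OF proper_square]) simp
    obtain K where K: "S ^ 2 = gser P (\<lambda>i. sgn_pow (- 1) i ^ 2) (\<lambda>i. 2 * (i * i)) + 2 * K"
      unfolding S_def using gser_square[OF p] by blast
    have "gser P (\<lambda>i. sgn_pow (- 1) i ^ 2) (\<lambda>i. 2 * (i * i)) = (S oo fps_X ^ 2) +
        2 * gser P (\<lambda>x. if even x then 0 else 1) (\<lambda>i. 2 * (i * i))"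
      unfolding S_def gser_compose_X_power[OF zero_less_numeral p] of_nat_numeral gser_numeral gser_add
      by (rule gser_cong) (auto simp: sgn_pow_def)
    then have "S ^ 2 = (S oo fps_X ^ 2) + 2 * (gser P (\<lambda>x. if even x then 0 else 1) (\<lambda>i. 2 * (i * i)) + K)"
      unfolding K distrib_left by (simp only: add.assoc)
    then show ?thesis by blast
  qed
  show ?thesis by (rule that[OF 1 2[unfolded 3] _ 5]) (simp only: 1 4)
qed

text \<open>With theta = 1 + 2 S and S2 = S(q^2), everything but the degree 4 part of
  \<open>4 D\<close> is matched by powers of \<open>theta\<close> up to the third. For that part S^4
  = S2^2 mod 4, and 24 S2^2 = 6 (1 + 2 S2)^2 - 12 (1 + 2 S2) + 6. By \<open>e2\<close> the first
  summand gives the term in \<open>theta_pos\<close>; by \<open>e1\<close> the second gives the term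
  in \<open>T(-q)\<close>.\<close>

lemma DSOME_gf_mod_32:
  "\<exists>K. 4 * Abs_fps DSOME + (lin_theta * theta - 2 * lin_theta + 9 * (qpoch (- 1) 1 1 * theta)
     - 2 * qpoch (- 1) 1 1 + 6 * (lin_theta * theta_pos) - 12 * (lin_theta oo (- fps_X))) = 32 * K"
proof -
  define E where "E = qpoch (- 1) 1 1"
  define D where "D = Abs_fps DSOME"
  define C G H where "C = qpoch (- 1) 2 1" and "G = qpoch 1 2 1" and "H = qpoch (- 1) 2 2"
  obtain S M K where th: "theta = 1 + 2 * S" and thp: "theta_pos = 1 + 2 * (S + 2 * M)"
    and th2: "(theta oo fps_X ^ 2) = 1 + 2 * (S oo fps_X ^ 2)" and sq: "S ^ 2 = (S oo fps_X ^ 2) + 2 * K"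
    using theta_split by metis
  define S2 where "S2 = (S oo fps_X ^ 2)"
  define E' where "E' = (E oo (- fps_X))"
  have prods: "E = C * H" "theta = H * C ^ 2" "theta_pos = H * G ^ 2"
    "1 + 2 * S2 = H * G * C" "E' = G * H"
    unfolding E_def C_def G_def H_def E'_def th2 [symmetric] S2_def
    by (rule euler_even_odd theta_product theta_pos_product theta_compose_sq euler_compose_uminus)+
  have T: "lin_theta = E * theta ^ 2" unfolding E_def by (rule lin_theta_eq)
  have T': "(lin_theta oo (- fps_X)) = E' * theta_pos ^ 2"
    unfolding T E'_def power2_eq_square by (simp add: fps_compose_mult_distrib theta_compose_uminus)
  have "theta * (8 * D) = theta * (qpoch 1 2 1 * qpoch 1 2 2) - E * theta ^ 4"
    unfolding D_def DSOME_eta_quotient E_def right_diff_distrib by (simp add: eval_nat_numeral mult_ac)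
  also have "theta * (qpoch 1 2 1 * qpoch 1 2 2) = E * (qpoch 1 2 1 * qpoch 1 2 2 * qpoch (- 1) 2 1)"
    unfolding prods(1,2) C_def H_def by (simp add: power2_eq_square mult_ac)
  finally have "theta * (8 * D) = E - E * theta ^ 4" unfolding euler_distinct_odd by simp
  then have "8 * (theta * D) = 8 * (- (E * (S + 3 * S ^ 2 + 4 * S ^ 3 + 2 * S ^ 4)))"
    unfolding th by algebra
  then have thD: "theta * D = - (E * (S + 3 * S ^ 2 + 4 * S ^ 3 + 2 * S ^ 4))"
    by (simp only: mult_cancel_left) simp
  \<comment> \<open>As theta^4 = 1 mod 8, theta^3 inverts theta modulo 8. The last summand is
    (theta^4 - 1) / 8 times \<open>D\<close>; the first collects the multiples of 8 in theta^3
    (theta D). The quartic part kept below is 6 theta S^4, with the factor theta that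
    \<open>e1\<close> and \<open>e2\<close> need.\<close>
  define K1 where "K1 = E * (S ^ 2 + 4 * S ^ 3 + 8 * S ^ 4 + 9 * S ^ 5 + 7 * S ^ 6 + 2 * S ^ 7)
    + (S + 3 * S ^ 2 + 4 * S ^ 3 + 2 * S ^ 4) * D"
  have D: "D = - (E * (S + S ^ 2 + 2 * S ^ 3 + 6 * (1 + 2 * S) * S ^ 4)) - 8 * K1"
    using thD unfolding th K1_def by algebra
  have "S2 = S ^ 2 - 2 * K" using sq by (simp add: S2_def)
  define K2 where "K2 = K * S2 + K ^ 2"
  have S4: "S ^ 4 = S2 ^ 2 + 4 * K2"
    using sq unfolding K2_def S2_def [symmetric] by algebra
  have e1: "E * theta * (1 + 2 * S2) = E' * theta ^ 2"
    unfolding prods by algebra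
  have e2: "(1 + 2 * S2) ^ 2 = theta * theta_pos"
    unfolding prods by algebra
  have "4 * D + (E * theta ^ 2 * theta - 2 * (E * theta ^ 2) + 9 * (E * theta) - 2 * E
      + 6 * (E * theta ^ 2 * theta_pos) - 12 * (E' * theta_pos ^ 2))
    = 32 * (- K1 - 3 * (E * theta * K2) - 3 * (E' * (M * theta + 2 * M ^ 2)))"
  proof -
    \<comment> \<open>Hence theta_pos^2 differs from theta^2 by a multiple of 8, and the coefficient
      12 raises this to 96 = 3 * 32.\<close>
    have "theta_pos = theta + 4 * M" unfolding th thp by algebra
    then have a: "12 * (E' * theta_pos ^ 2) = 12 * (E * theta * (1 + 2 * S2)) + 96 * (E' * (M * theta + 2 * M ^ 2))"
      unfolding e1 by algebra
    have b: "6 * (E * theta ^ 2 * theta_pos) = 6 * (E * theta * (1 + 2 * S2) ^ 2)"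
      unfolding e2 by algebra
    show ?thesis unfolding a b D unfolding th using S4 by algebra
  qed
  then show ?thesis unfolding T' unfolding T E_def [symmetric] D_def [symmetric] by blast
qed

section \<open>Multiplication of the index by 25\<close>

text \<open>Elements n + 2 x sqrt(-6) of norm \<open>M\<close>. For M = 24 N + 1, \<open>n\<close>
  is prime to 6, and the congruence picks one of the signs of \<open>n\<close>.\<close>

definition qf_set :: "int \<Rightarrow> (int \<times> int) set" where
  "qf_set M = {(n, x). n mod 6 = 1 \<and> n * n + 24 * (x * x) = M}"

definition qf_sum :: "(int \<Rightarrow> int \<Rightarrow> int) \<Rightarrow> int \<Rightarrow> int" where
  "qf_sum w M = (\<Sum>(n, x)\<in>qf_set M. w n x)"

lemma abs_le_square: "\<bar>x\<bar> \<le> x * x" for x :: int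
  using self_le_power[of "\<bar>x\<bar>" 2] by (cases "x = 0") (auto simp: power2_eq_square)

lemma finite_qf_set: "finite (qf_set M)"
proof (rule finite_subset)
  show "qf_set M \<subseteq> {- M..M} \<times> {- M..M}"
  proof
    fix z assume "z \<in> qf_set M"
    then obtain n x where z: "z = (n, x)" "n * n + 24 * (x * x) = M" by (auto simp: qf_set_def)
    have "\<bar>n\<bar> \<le> n * n" "\<bar>x\<bar> \<le> x * x" by (rule abs_le_square)+
    then have "\<bar>n\<bar> \<le> M" "\<bar>x\<bar> \<le> M" using z(2) by linarith+
    then show "z \<in> {- M..M} \<times> {- M..M}" unfolding z(1) by auto
  qed
qed simp

text \<open>Since 25 divides x^2 - n^2, it divides one factor unless 5 divides both, hence both
  \<open>n\<close> and \<open>x\<close>. In that case 125 in place of 25 leaves a factor 5 after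
  division by 25, and the same identity decides for the quotients. In terms of ideals: a norm
  divisible by 5^3 forces the square of one prime above 5.\<close>

lemma dvd_25_cases:
  fixes n x :: int
  assumes "125 dvd n * n + 24 * (x * x)"
  shows "25 dvd x - n \<or> 25 dvd x + n"
proof -
  have eq: "(x - n) * (x + n) = 25 * (x * x) - (n * n + 24 * (x * x))" by (simp add: algebra_simps)
  have "25 dvd n * n + 24 * (x * x)" using assms by (rule dvd_trans[rotated]) simp
  then have d25: "25 dvd (x - n) * (x + n)" unfolding eq by (intro dvd_diff) simp_all
  have cop: "coprime 25 y" if "\<not> 5 dvd y" for y :: int
  proof -
    have "prime (5::int)" by simp
    then have "coprime 5 y" using that by (rule prime_imp_coprime)
    then have "coprime (5 ^ 2) y" by (simp only: coprime_power_left_iff) simp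
    then show ?thesis by simp
  qed
  show ?thesis
  proof (cases "5 dvd x - n \<and> 5 dvd x + n")
    case True
    then have "5 dvd n" "5 dvd x" by presburger+
    then obtain p q where pq: "n = 5 * p" "x = 5 * q" by (auto elim!: dvdE)
    with assms have "25 * 5 dvd 25 * (p * p + 24 * (q * q))" by (simp add: algebra_simps)
    then have "5 dvd p * p + 24 * (q * q)" by (simp only: dvd_mult_cancel_left) simp
    then have "5 dvd 25 * (q * q) - (p * p + 24 * (q * q))" by (intro dvd_diff) simp_all
    also have "25 * (q * q) - (p * p + 24 * (q * q)) = (q - p) * (q + p)" by (simp add: algebra_simps)
    finally have "5 dvd q - p \<or> 5 dvd q + p" by (simp add: prime_dvd_mult_iff)
    then show ?thesis unfolding pq by presburger
  next
    case False
    then show ?thesis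
    proof (cases "5 dvd x - n")
      case True
      with False have "coprime 25 (x + n)" by (intro cop) simp
      then show ?thesis using d25 coprime_dvd_mult_left_iff by blast
    next
      case False
      then have "coprime 25 (x - n)" by (rule cop)
      then show ?thesis using d25 coprime_dvd_mult_right_iff by blast
    qed
  qed
qed

text \<open>The maps \<open>(a, b) \<mapsto> (a - 24 b, a + b)\<close> and \<open>(a, b) \<mapsto> (a + 24 b, b - a)\<close> are multiplication of
  \<open>a + 2 b \<surd>-6\<close> by the two elements \<open>1 \<plusminus> 2 \<surd>-6\<close> of norm 25.\<close>

lemma qf_set_dvd_minus:
  "{(n, x) \<in> qf_set (25 * K). 25 dvd x - n} = (\<lambda>(a, b). (a - 24 * b, a + b)) ` qf_set K"
proof (intro equalityI subsetI)
  fix z assume "z \<in> {(n, x) \<in> qf_set (25 * K). 25 dvd x - n}"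
  then obtain n x where z: "z = (n, x)" "n mod 6 = 1" "n * n + 24 * (x * x) = 25 * K" "25 dvd x - n"
    by (auto simp: qf_set_def)
  then obtain b where b: "x - n = 25 * b" by (auto elim: dvdE)
  define a where "a = x - b"
  have nx: "n = a - 24 * b" "x = a + b" using b by (simp_all add: a_def)
  have "25 * (a * a + 24 * (b * b)) = 25 * K"
    unfolding z(3) [symmetric] nx by (simp add: algebra_simps)
  moreover have "a mod 6 = 1" using z(2) unfolding nx by presburger
  ultimately have "(a, b) \<in> qf_set K" by (simp add: qf_set_def)
  then show "z \<in> (\<lambda>(a, b). (a - 24 * b, a + b)) ` qf_set K"
    by (rule rev_image_eqI) (simp add: z(1) nx)
next
  fix z assume "z \<in> (\<lambda>(a, b). (a - 24 * b, a + b)) ` qf_set K"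
  then obtain a b where z: "z = (a - 24 * b, a + b)" "a mod 6 = 1" "a * a + 24 * (b * b) = K"
    by (auto simp: qf_set_def)
  have "(a - 24 * b) mod 6 = 1" using z(2) by presburger
  moreover have "a + b - (a - 24 * b) = 25 * b" by simp
  moreover have "(a - 24 * b) * (a - 24 * b) + 24 * ((a + b) * (a + b)) = 25 * K"
    unfolding z(3) [symmetric] by (simp add: algebra_simps)
  ultimately show "z \<in> {(n, x) \<in> qf_set (25 * K). 25 dvd x - n}"
    unfolding z(1) qf_set_def by (simp only: mem_Collect_eq prod.case) simp
qed

lemma qf_set_dvd_plus:
  "{(n, x) \<in> qf_set (25 * K). 25 dvd x + n} = (\<lambda>(a, b). (a + 24 * b, b - a)) ` qf_set K"
proof (intro equalityI subsetI)
  fix z assume "z \<in> {(n, x) \<in> qf_set (25 * K). 25 dvd x + n}"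
  then obtain n x where z: "z = (n, x)" "n mod 6 = 1" "n * n + 24 * (x * x) = 25 * K" "25 dvd x + n"
    by (auto simp: qf_set_def)
  then obtain b where b: "x + n = 25 * b" by (auto elim: dvdE)
  define a where "a = b - x"
  have nx: "n = a + 24 * b" "x = b - a" using b by (simp_all add: a_def)
  have "25 * (a * a + 24 * (b * b)) = 25 * K"
    unfolding z(3) [symmetric] nx by (simp add: algebra_simps)
  moreover have "a mod 6 = 1" using z(2) unfolding nx by presburger
  ultimately have "(a, b) \<in> qf_set K" by (simp add: qf_set_def)
  then show "z \<in> (\<lambda>(a, b). (a + 24 * b, b - a)) ` qf_set K"
    by (rule rev_image_eqI) (simp add: z(1) nx)
next
  fix z assume "z \<in> (\<lambda>(a, b). (a + 24 * b, b - a)) ` qf_set K"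
  then obtain a b where z: "z = (a + 24 * b, b - a)" "a mod 6 = 1" "a * a + 24 * (b * b) = K"
    by (auto simp: qf_set_def)
  have "(a + 24 * b) mod 6 = 1" using z(2) by presburger
  moreover have "b - a + (a + 24 * b) = 25 * b" by simp
  moreover have "(a + 24 * b) * (a + 24 * b) + 24 * ((b - a) * (b - a)) = 25 * K"
    unfolding z(3) [symmetric] by (simp add: algebra_simps)
  ultimately show "z \<in> {(n, x) \<in> qf_set (25 * K). 25 dvd x + n}"
    unfolding z(1) qf_set_def by (simp only: mem_Collect_eq prod.case) simp
qed

text \<open>The conjugates 1 + 2 sqrt(-6) and 1 - 2 sqrt(-6) are coprime with product 25, so a
  common multiple is a multiple of 25.\<close>

lemma qf_set_dvd_both:
  "{(n, x) \<in> qf_set (25 * K). 25 dvd x - n} \<inter> {(n, x) \<in> qf_set (25 * K). 25 dvd x + n} =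
    (if 25 dvd K then (\<lambda>(a, b). (25 * a, 25 * b)) ` qf_set (K div 25) else {})" (is "?L = ?R")
proof (intro equalityI subsetI)
  fix z assume "z \<in> ?L"
  then obtain n x where z: "z = (n, x)" "n mod 6 = 1" "n * n + 24 * (x * x) = 25 * K"
    "25 dvd x - n" "25 dvd x + n"
    by (auto simp: qf_set_def)
  from z(4,5) have "25 dvd n" "25 dvd x" by presburger+
  then obtain p q where pq: "n = 25 * p" "x = 25 * q" by (auto elim!: dvdE)
  have K: "K = 25 * (p * p + 24 * (q * q))" using z(3) unfolding pq by (simp add: algebra_simps)
  moreover have "p mod 6 = 1" using z(2) unfolding pq by presburger
  ultimately have "(p, q) \<in> qf_set (K div 25)" by (simp add: qf_set_def)
  then show "z \<in> ?R" using K by (auto simp: z(1) pq intro!: rev_image_eqI)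
next
  fix z assume "z \<in> ?R"
  then have dvd: "25 dvd K" and "z \<in> (\<lambda>(a, b). (25 * a, 25 * b)) ` qf_set (K div 25)"
    by (auto split: if_splits)
  then obtain p q where z: "z = (25 * p, 25 * q)" "p mod 6 = 1" "p * p + 24 * (q * q) = K div 25"
    by (auto simp: qf_set_def)
  have "K = 25 * (p * p + 24 * (q * q))" using dvd unfolding z(3) by simp
  then have "25 * p * (25 * p) + 24 * (25 * q * (25 * q)) = 25 * K" by (simp add: algebra_simps)
  moreover have "25 * p mod 6 = 1" using z(2) by presburger
  moreover have "25 dvd 25 * q - 25 * p" "25 dvd 25 * q + 25 * p" by simp_all
  ultimately show "z \<in> ?L" unfolding z(1) qf_set_def by simp
qed

text \<open>Inclusion-exclusion over the multiples of the two elements of norm 25. The assumption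
  \<open>5 dvd K\<close> makes these multiples exhaust the elements of norm \<open>25 * K\<close>;
  otherwise 5 times an element of norm \<open>K\<close> would be a third kind.\<close>

lemma qf_sum_hecke:
  assumes K: "5 dvd K"
    and w: "\<And>a b. a mod 6 = 1 \<Longrightarrow> w (a - 24 * b) (a + b) + w (a + 24 * b) (b - a) = c * w a b"
    and w25: "\<And>a b. a mod 6 = 1 \<Longrightarrow> w (25 * a) (25 * b) = d * w a b"
  shows "qf_sum w (25 * K) = c * qf_sum w K - d * (if 25 dvd K then qf_sum w (K div 25) else 0)"
proof -
  define A where "A = {(n, x) \<in> qf_set (25 * K). 25 dvd x - n}"
  define B where "B = {(n, x) \<in> qf_set (25 * K). 25 dvd x + n}"
  have "qf_set (25 * K) = A \<union> B"
  proof -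
    have "25 dvd x - n \<or> 25 dvd x + n" if "(n, x) \<in> qf_set (25 * K)" for n x
    proof (rule dvd_25_cases)
      have "25 * 5 dvd 25 * K" using K by (intro mult_dvd_mono) simp_all
      then show "125 dvd n * n + 24 * (x * x)" using that by (simp add: qf_set_def)
    qed
    then show ?thesis unfolding A_def B_def by auto
  qed
  moreover have "finite A" "finite B"
    unfolding A_def B_def by (rule finite_subset[OF _ finite_qf_set[of "25 * K"]], auto)+
  ultimately have "qf_sum w (25 * K) = (\<Sum>(n, x)\<in>A. w n x) + (\<Sum>(n, x)\<in>B. w n x) - (\<Sum>(n, x)\<in>A \<inter> B. w n x)"
    unfolding qf_sum_def by (simp add: sum_Un)
  moreover have "(\<Sum>(n, x)\<in>A. w n x) = (\<Sum>(a, b)\<in>qf_set K. w (a - 24 * b) (a + b))"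
    unfolding A_def qf_set_dvd_minus by (subst sum.reindex) (auto simp: inj_on_def intro!: sum.cong)
  moreover have "(\<Sum>(n, x)\<in>B. w n x) = (\<Sum>(a, b)\<in>qf_set K. w (a + 24 * b) (b - a))"
    unfolding B_def qf_set_dvd_plus by (subst sum.reindex) (auto simp: inj_on_def intro!: sum.cong)
  moreover have "(\<Sum>(a, b)\<in>qf_set K. w (a - 24 * b) (a + b)) + (\<Sum>(a, b)\<in>qf_set K. w (a + 24 * b) (b - a))
      = c * qf_sum w K"
    unfolding qf_sum_def sum.distrib [symmetric] sum_distrib_left
    by (rule sum.cong) (auto simp: qf_set_def w)
  moreover have "(\<Sum>(n, x)\<in>A \<inter> B. w n x) = d * (if 25 dvd K then qf_sum w (K div 25) else 0)"
  proof (cases "25 dvd K")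
    case True
    have "(\<Sum>(n, x)\<in>A \<inter> B. w n x) = (\<Sum>(a, b)\<in>qf_set (K div 25). w (25 * a) (25 * b))"
      unfolding A_def B_def qf_set_dvd_both if_P[OF True]
      by (subst sum.reindex) (auto simp: inj_on_def intro!: sum.cong)
    also have "\<dots> = d * qf_sum w (K div 25)"
      unfolding qf_sum_def sum_distrib_left by (rule sum.cong) (auto simp: qf_set_def w25)
    finally show ?thesis using True by simp
  next
    case False
    then show ?thesis unfolding A_def B_def qf_set_dvd_both if_not_P[OF False] by simp
  qed
  ultimately show ?thesis by linarith
qed

section \<open>The unary series\<close>

definition sq_sum :: "(int \<Rightarrow> int) \<Rightarrow> int \<Rightarrow> int" where
  "sq_sum w M = (\<Sum>n\<in>{n. n mod 6 = 1 \<and> n * n = M}. w n)"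

text \<open>Of the two roots 5 and -5 of 25, it is -5 that preserves the class 1 modulo 6. This is
  the sign in the eigenvalues -1 and -5 used later.\<close>

lemma sq_sum_hecke:
  assumes "\<And>n. n mod 6 = 1 \<Longrightarrow> w (- 5 * n) = c * w n"
  shows "sq_sum w (25 * K) = c * sq_sum w K"
proof -
  have five: "5 dvd n" if "n * n = 25 * K" for n
  proof -
    have "5 dvd n * n" unfolding that by simp
    then show ?thesis by (simp add: prime_dvd_mult_iff)
  qed
  have "{n. n mod 6 = 1 \<and> n * n = 25 * K} = (\<lambda>n. - 5 * n) ` {n. n mod 6 = 1 \<and> n * n = K}"
  proof (intro equalityI subsetI)
    fix n assume n: "n \<in> {n. n mod 6 = 1 \<and> n * n = 25 * K}"
    then obtain m where m: "n = 5 * m" using five[of n] by (auto elim: dvdE)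
    have "(- m) mod 6 = 1" using n unfolding m mem_Collect_eq by presburger
    moreover have "(- m) * (- m) = K" using n unfolding m by simp
    ultimately show "n \<in> (\<lambda>n. - 5 * n) ` {n. n mod 6 = 1 \<and> n * n = K}"
      by (intro image_eqI[of _ _ "- m"]) (simp_all add: m)
  next
    fix n assume "n \<in> (\<lambda>n. - 5 * n) ` {n. n mod 6 = 1 \<and> n * n = K}"
    then obtain m where m: "n = - 5 * m" "m mod 6 = 1" "m * m = K" by auto
    have "- 5 * m mod 6 = 1" using m(2) by presburger
    moreover have "- 5 * m * (- 5 * m) = 25 * K" unfolding m(3) [symmetric] by simp
    ultimately show "n \<in> {n. n mod 6 = 1 \<and> n * n = 25 * K}" unfolding m(1) by blast
  qed
  then have "sq_sum w (25 * K) = (\<Sum>n\<in>{n. n mod 6 = 1 \<and> n * n = K}. w (- 5 * n))"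
    unfolding sq_sum_def by (simp only:) (subst sum.reindex, auto simp: inj_on_def)
  also have "\<dots> = c * sq_sum w K"
    unfolding sq_sum_def sum_distrib_left by (rule sum.cong) (auto simp: assms simp del: mult_minus_left)
  finally show ?thesis .
qed

lemma sq_sum_eq_0:
  assumes "5 dvd K" "\<not> 25 dvd K"
  shows "sq_sum w K = 0"
proof -
  have "n * n \<noteq> K" for n
  proof
    assume n: "n * n = K"
    then have "5 dvd n" using assms(1) by (auto simp: prime_dvd_mult_iff)
    then have "5 * 5 dvd n * n" by (intro mult_dvd_mono)
    then show False using n assms(2) by simp
  qed
  then show ?thesis unfolding sq_sum_def by simp
qed

section \<open>Coefficients as sums over the index 24 N + 1\<close>

lemma gser_qf_nth:
  "gser (UNIV \<times> UNIV) (\<lambda>(t, x). w (6 * t + 1) x) (\<lambda>(t, x). pent t + x * x) $ N = qf_sum w (24 * int N + 1)"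
  unfolding gser_nth qf_sum_def
proof (rule sum.reindex_bij_witness[where j = "\<lambda>(t, x). (6 * t + 1, x)" and i = "\<lambda>(n, x). (n div 6, x)"])
  have key: "(6 * t + 1) * (6 * t + 1) + 24 * (x * x) = 24 * (pent t + x * x) + 1" for t x
    using two_pent[of t] by (simp add: algebra_simps)
  {
    fix z :: "int \<times> int" assume z: "z \<in> {i \<in> UNIV \<times> UNIV. (case i of (t, x) \<Rightarrow> pent t + x * x) = int N}"
    obtain t x where tx: "z = (t, x)" by (cases z)
    show "(case (case z of (t, x) \<Rightarrow> (6 * t + 1, x)) of (n, x) \<Rightarrow> (n div 6, x)) = z"
      unfolding tx by simp
    have "(6 * t + 1) mod 6 = 1" by presburger
    then show "(case z of (t, x) \<Rightarrow> (6 * t + 1, x)) \<in> qf_set (24 * int N + 1)"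
      using z key[of t x] unfolding tx qf_set_def by simp
    show "(case (case z of (t, x) \<Rightarrow> (6 * t + 1, x)) of (n, x) \<Rightarrow> w n x) = (case z of (t, x) \<Rightarrow> w (6 * t + 1) x)"
      unfolding tx by simp
  }
  fix z assume z: "z \<in> qf_set (24 * int N + 1)"
  obtain n x where nx: "z = (n, x)" by (cases z)
  have n: "n = 6 * (n div 6) + 1" using z unfolding nx qf_set_def by (simp, presburger)
  then show "(case (case z of (n, x) \<Rightarrow> (n div 6, x)) of (t, x) \<Rightarrow> (6 * t + 1, x)) = z"
    unfolding nx by simp
  show "(case z of (n, x) \<Rightarrow> (n div 6, x)) \<in> {i \<in> UNIV \<times> UNIV. (case i of (t, x) \<Rightarrow> pent t + x * x) = int N}"
    using z key[of "n div 6" x] unfolding nx n [symmetric] qf_set_def by simp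
qed

lemma gser_sq_nth:
  "gser UNIV (\<lambda>t. w (6 * t + 1)) pent $ N = sq_sum w (24 * int N + 1)"
  unfolding gser_nth sq_sum_def
proof (rule sum.reindex_bij_witness[where j = "\<lambda>t. 6 * t + 1" and i = "\<lambda>n. n div 6"])
  have key: "(6 * t + 1) * (6 * t + 1) = 24 * pent t + 1" for t
    using two_pent[of t] by (simp add: algebra_simps)
  show "(6 * t + 1) div 6 = t" for t :: int by simp
  show "6 * t + 1 \<in> {n. n mod 6 = 1 \<and> n * n = 24 * int N + 1}" if "t \<in> {i \<in> UNIV. pent i = int N}" for t
  proof -
    have "(6 * t + 1) mod 6 = 1" by presburger
    then show ?thesis using that by (simp only: mem_Collect_eq key)
  qed
  fix n :: int assume z: "n \<in> {n. n mod 6 = 1 \<and> n * n = 24 * int N + 1}"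
  then have n: "n = 6 * (n div 6) + 1" unfolding mem_Collect_eq by presburger
  then show "6 * (n div 6) + 1 = n" by simp
  show "n div 6 \<in> {i \<in> UNIV. pent i = int N}"
    using z key[of "n div 6"] unfolding n [symmetric] by simp
qed simp

text \<open>On n = 1 mod 6 this is the Kronecker symbol (12/n), hence its invariance under shifts by
  multiples of 24.\<close>

definition chi :: "int \<Rightarrow> int" where
  "chi n = sgn_pow (- 1) ((n - 1) div 6)"

lemma chi_eq: "chi (6 * t + 1) = sgn_pow (- 1) t"
  by (simp add: chi_def)

lemma chi_shift:
  assumes "a mod 6 = 1"
  shows "chi (a - 24 * b) = chi a" "chi (a + 24 * b) = chi a" "chi (25 * a) = chi a" "chi (- 5 * a) = - chi a"
proof -
  obtain t where a: "a = 6 * t + 1" using assms by (metis mult_div_mod_eq)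
  have "a - 24 * b = 6 * (t - 4 * b) + 1" "a + 24 * b = 6 * (t + 4 * b) + 1"
    "25 * a = 6 * (25 * t + 4) + 1" "- 5 * a = 6 * (- 5 * t - 1) + 1"
    unfolding a by (simp_all add: algebra_simps)
  then show "chi (a - 24 * b) = chi a" "chi (a + 24 * b) = chi a" "chi (25 * a) = chi a"
    "chi (- 5 * a) = - chi a"
    unfolding a by (simp_all only: chi_eq) (auto simp: sgn_pow_def)
qed

lemma sgn_pow_sum:
  fixes a b :: int
  assumes "a mod 6 = 1"
  shows "sgn_pow (- 1) (a + b) = - sgn_pow (- 1) b" "sgn_pow (- 1) (b - a) = - sgn_pow (- 1) b"
proof -
  have "odd a" using assms by presburger
  then show "sgn_pow (- 1) (a + b) = - sgn_pow (- 1) b" "sgn_pow (- 1) (b - a) = - sgn_pow (- 1) b"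
    by (simp_all add: sgn_pow_def)
qed

section \<open>The three binary weights and their eigenvalues\<close>

definition chi_weight :: "int \<Rightarrow> int \<Rightarrow> int" where "chi_weight n x = chi n * sgn_pow (- 1) x"
definition lin_weight :: "int \<Rightarrow> int \<Rightarrow> int" where "lin_weight n x = n * sgn_pow (- 1) x"
definition pos_weight :: "int \<Rightarrow> int \<Rightarrow> int" where "pos_weight n x = n"

text \<open>As \<open>a\<close> is odd, both \<open>a + b\<close> and \<open>b - a\<close> reverse
  the sign of \<open>b\<close>, while \<open>chi\<close> ignores the shift by \<open>24 * b\<close>;
  the two terms coincide and give -2. For the linear weights below, the contributions of
  \<open>24 * b\<close> cancel instead.\<close>

lemma hecke_chi_weight:
  assumes "5 dvd K"
  shows "qf_sum chi_weight (25 * K) = - 2 * qf_sum chi_weight K - 1 * (if 25 dvd K then qf_sum chi_weight (K div 25) else 0)"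
  by (rule qf_sum_hecke[OF assms]) (simp_all add: chi_weight_def chi_shift sgn_pow_sum, simp_all add: sgn_pow_def)

lemma hecke_lin_weight:
  assumes "5 dvd K"
  shows "qf_sum lin_weight (25 * K) = - 2 * qf_sum lin_weight K - 25 * (if 25 dvd K then qf_sum lin_weight (K div 25) else 0)"
  by (rule qf_sum_hecke[OF assms]) (simp_all add: lin_weight_def sgn_pow_sum algebra_simps, simp_all add: sgn_pow_def)

lemma hecke_pos_weight:
  assumes "5 dvd K"
  shows "qf_sum pos_weight (25 * K) = 2 * qf_sum pos_weight K - 25 * (if 25 dvd K then qf_sum pos_weight (K div 25) else 0)"
  by (rule qf_sum_hecke[OF assms]) (simp_all add: pos_weight_def)

lemma fps_numeral_mult_nth: "(numeral c * f :: int fps) $ n = numeral c * f $ n"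
  by (simp add: numeral_fps_const)

lemma theta_coeffs:
  "(qpoch (- 1) 1 1 * theta) $ N = qf_sum chi_weight (24 * int N + 1)"
  "(lin_theta * theta) $ N = qf_sum lin_weight (24 * int N + 1)"
  "(lin_theta * theta_pos) $ N = qf_sum pos_weight (24 * int N + 1)"
  "qpoch (- 1) 1 1 $ N = sq_sum chi (24 * int N + 1)"
  "lin_theta $ N = sq_sum (\<lambda>n. n) (24 * int N + 1)"
proof -
  have "qpoch (- 1) 1 1 * theta =
      gser (UNIV \<times> UNIV) (\<lambda>(t, x). chi_weight (6 * t + 1) x) (\<lambda>(t, x). pent t + x * x)"
    unfolding pentagonal theta_def gser_mult[OF proper_pent proper_square] chi_weight_def chi_eq ..
  then show "(qpoch (- 1) 1 1 * theta) $ N = qf_sum chi_weight (24 * int N + 1)"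
    by (simp only: gser_qf_nth)
  have "lin_theta * theta =
      gser (UNIV \<times> UNIV) (\<lambda>(t, x). lin_weight (6 * t + 1) x) (\<lambda>(t, x). pent t + x * x)"
    unfolding lin_theta_def theta_def gser_mult[OF proper_pent proper_square] lin_weight_def ..
  then show "(lin_theta * theta) $ N = qf_sum lin_weight (24 * int N + 1)"
    by (simp only: gser_qf_nth)
  have "lin_theta * theta_pos =
      gser (UNIV \<times> UNIV) (\<lambda>(t, x). pos_weight (6 * t + 1) x) (\<lambda>(t, x). pent t + x * x)"
    unfolding lin_theta_def theta_pos_def gser_mult[OF proper_pent proper_square] pos_weight_def mult_1_right ..
  then show "(lin_theta * theta_pos) $ N = qf_sum pos_weight (24 * int N + 1)"
    by (simp only: gser_qf_nth)
  have "qpoch (- 1) 1 1 = gser UNIV (\<lambda>t. chi (6 * t + 1)) pent"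
    unfolding pentagonal chi_eq ..
  then show "qpoch (- 1) 1 1 $ N = sq_sum chi (24 * int N + 1)"
    by (simp only: gser_sq_nth)
  show "lin_theta $ N = sq_sum (\<lambda>n. n) (24 * int N + 1)"
    unfolding lin_theta_def by (rule gser_sq_nth)
qed

section \<open>The congruence\<close>

lemma DSOME_theta_mod_32:
  fixes N :: nat
  defines "M \<equiv> 24 * int N + 1"
  shows "\<exists>k. 4 * DSOME N + (qf_sum lin_weight M - 2 * sq_sum (\<lambda>n. n) M + 9 * qf_sum chi_weight M - 2 * sq_sum chi M
      + 6 * qf_sum pos_weight M - 12 * ((- 1) ^ N * sq_sum (\<lambda>n. n) M)) = 32 * k"
proof -
  obtain K where K: "4 * Abs_fps DSOME + (lin_theta * theta - 2 * lin_theta + 9 * (qpoch (- 1) 1 1 * theta)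
     - 2 * qpoch (- 1) 1 1 + 6 * (lin_theta * theta_pos) - 12 * (lin_theta oo (- fps_X))) = 32 * K"
    using DSOME_gf_mod_32 by blast
  have "(4 * Abs_fps DSOME + (lin_theta * theta - 2 * lin_theta + 9 * (qpoch (- 1) 1 1 * theta)
     - 2 * qpoch (- 1) 1 1 + 6 * (lin_theta * theta_pos) - 12 * (lin_theta oo (- fps_X)))) $ N = 32 * K $ N"
    unfolding K by (rule fps_numeral_mult_nth)
  then show ?thesis
    unfolding fps_add_nth fps_sub_nth fps_numeral_mult_nth fps_compose_uminus' fps_nth_Abs_fps theta_coeffs M_def
    by blast
qed

text \<open>From theta^2 = 1 mod 4 the series \<open>T\<close> and \<open>E\<close> agree modulo 4,
  and \<open>theta_pos\<close> agrees with \<open>theta\<close> modulo 4. This merges series whose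
  separate remainders under the operator are not divisible by 32; for the unary pair, agreement
  modulo 2 is enough.\<close>

lemma theta_coeffs_mod:
  fixes N :: nat
  defines "M \<equiv> 24 * int N + 1"
  shows "\<exists>k. qf_sum lin_weight M = qf_sum chi_weight M + 4 * k" "\<exists>k. qf_sum pos_weight M = qf_sum chi_weight M + 4 * k"
    "\<exists>k. sq_sum (\<lambda>n. n) M = sq_sum chi M + 2 * k"
proof -
  define E where "E = qpoch (- 1) 1 1"
  obtain S A where th: "theta = 1 + 2 * S" and thp: "theta_pos = 1 + 2 * (S + 2 * A)"
    using theta_split by metis
  have T: "lin_theta = E * theta ^ 2" unfolding E_def by (rule lin_theta_eq)
  have "lin_theta * theta = E * theta + 4 * (E * theta * (S + S ^ 2))"
    unfolding T th by algebra
  then have "(lin_theta * theta) $ N = (E * theta) $ N + 4 * (E * theta * (S + S ^ 2)) $ N"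
    by (simp only: fps_add_nth fps_numeral_mult_nth)
  then show "\<exists>k. qf_sum lin_weight M = qf_sum chi_weight M + 4 * k"
    unfolding theta_coeffs E_def M_def by blast
  have "lin_theta * theta_pos = E * theta + 4 * (E * theta * (S + S ^ 2) + E * theta ^ 2 * A)"
    unfolding T th thp by algebra
  then have "(lin_theta * theta_pos) $ N = (E * theta) $ N + 4 * (E * theta * (S + S ^ 2) + E * theta ^ 2 * A) $ N"
    by (simp only: fps_add_nth[of _ "4 * _"] fps_numeral_mult_nth)
  then show "\<exists>k. qf_sum pos_weight M = qf_sum chi_weight M + 4 * k"
    unfolding theta_coeffs E_def M_def by blast
  have "lin_theta = E + 2 * (E * (2 * S + 2 * S ^ 2))"
    unfolding T th by algebra
  then have "lin_theta $ N = E $ N + 2 * (E * (2 * S + 2 * S ^ 2)) $ N"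
    by (metis fps_add_nth fps_numeral_mult_nth)
  then show "\<exists>k. sq_sum (\<lambda>n. n) M = sq_sum chi M + 2 * k"
    unfolding theta_coeffs E_def M_def by blast
qed

text \<open>The operator \<open>X\<^sup>3 - X\<^sup>2 - 5 X + 5\<close> applied to the combination of eigenforms in
  \<open>DSOME_theta_mod_32\<close>, where \<open>X\<close> multiplies the index by 25.\<close>

lemma eigenform_combination:
  fixes D0 :: int
  assumes D: "4 * D0 + (p0 - 2 * t0 + 9 * e0 - 2 * g0 + 6 * r0 - 12 * u0) = 32 * k0"
    "4 * D1 + (p1 - 2 * t1 + 9 * e1 - 2 * g1 + 6 * r1 - 12 * u1) = 32 * k1"
    "4 * D2 + (p2 - 2 * t2 + 9 * e2 - 2 * g2 + 6 * r2 - 12 * u2) = 32 * k2"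
    "4 * D3 + (p3 - 2 * t3 + 9 * e3 - 2 * g3 + 6 * r3 - 12 * u3) = 32 * k3"
    and p: "p2 = - 2 * p1 - 25 * p0" "p3 = - 2 * p2 - 25 * p1"
    and r: "r2 = 2 * r1 - 25 * r0" "r3 = 2 * r2 - 25 * r1"
    and e: "e2 = - 2 * e1 - e0" "e3 = - 2 * e2 - e1"
    and g: "g1 = - g0" "g2 = - g1" "g3 = - g2"
    and t: "t1 = - 5 * t0" "t2 = - 5 * t1" "t3 = - 5 * t2"
    and u: "u1 = 5 * u0" "u2 = 5 * u1" "u3 = 5 * u2"
    and m: "p0 = e0 + 4 * a0" "p1 = e1 + 4 * a1" "r0 = e0 + 4 * b0" "r1 = e1 + 4 * b1" "t0 = g0 + 2 * h"
  shows "[D3 = 5 * D1 + D2 - 5 * D0] (mod 8)"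
proof -
  \<comment> \<open>The recurrences reduce the six parts to -24 p1 + 80 p0, 240 t0, 72 e0, -16 g0,
    -168 r1 - 120 r0 and -960 u0. Inserting the congruences makes the coefficients of
    \<open>e1\<close>, \<open>e0\<close>, \<open>g0\<close> equal to -192, 32, 224, while those of
    \<open>a0\<close>, \<open>a1\<close>, \<open>b0\<close>, \<open>b1\<close>, \<open>h\<close>,
    \<open>u0\<close> are multiples of 32 as well.\<close>
  have "4 * (D3 - (5 * D1 + D2 - 5 * D0)) = 4 * (8 * (k3 - k2 - 5 * k1 + 5 * k0
      - (- 6 * e1 + e0 - 3 * a1 + 10 * a0 - 21 * b1 - 15 * b0 + 7 * g0 + 15 * h - 30 * u0)))"
    using D unfolding p r e g t u m by algebra
  then have "D3 - (5 * D1 + D2 - 5 * D0) = 8 * (k3 - k2 - 5 * k1 + 5 * k0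
      - (- 6 * e1 + e0 - 3 * a1 + 10 * a0 - 21 * b1 - 15 * b0 + 7 * g0 + 15 * h - 30 * u0))"
    by (simp only: mult_cancel_left) simp
  then show ?thesis by (simp add: cong_iff_dvd_diff)
qed

theorem theorem1p4:
  shows "(\<forall>n::nat. [DSOME (15625 * n + 651)
              = 5 * DSOME (25 * n + 1) + DSOME (625 * n + 26) - 5 * DSOME n] (mod 8))
       \<and> (\<forall>(n::nat) (r::nat). 1 \<le> r \<and> r \<le> 4 \<longrightarrow>
            [DSOME (15625 * n + 3125 * r + 651)
              = 5 * DSOME (25 * n + 5 * r + 1) + DSOME (625 * n + 125 * r + 26)] (mod 8))"
proof (intro conjI allI impI)
  fix n :: nat
  define M0 M1 M2 M3 where "M0 = 24 * int n + 1" and "M1 = 25 * M0" and "M2 = 25 * M1" and "M3 = 25 * M2"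
  \<comment> \<open>The offsets 1, 26, 651 are (25^i - 1) / 24 for i = 1, 2, 3.\<close>
  have M: "24 * int (25 * n + 1) + 1 = M1" "24 * int (625 * n + 26) + 1 = M2"
    "24 * int (15625 * n + 651) + 1 = M3"
    by (simp_all add: M0_def M1_def M2_def M3_def)
  \<comment> \<open>Each step reverses the parity of the index, so the coefficients of
    \<open>T(-q)\<close> change sign relative to those of \<open>T\<close>, and the eigenvalue -5
    becomes 5.\<close>
  have s: "(- 1) ^ (25 * n + 1) = - ((- 1) ^ n :: int)" "(- 1) ^ (625 * n + 26) = ((- 1) ^ n :: int)"
    "(- 1) ^ (15625 * n + 651) = - ((- 1) ^ n :: int)"
    by (cases "even n"; simp add: uminus_power_if)+
  have dvd: "5 dvd M1" "25 dvd M1" "M1 div 25 = M0" "5 dvd M2" "25 dvd M2" "M2 div 25 = M1"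
    by (simp_all add: M1_def M2_def)
  define \<sigma> where "\<sigma> = ((- 1) ^ n :: int)"
  obtain k0 where k0: "4 * DSOME n + (qf_sum lin_weight M0 - 2 * sq_sum (\<lambda>n. n) M0 + 9 * qf_sum chi_weight M0
      - 2 * sq_sum chi M0 + 6 * qf_sum pos_weight M0 - 12 * (\<sigma> * sq_sum (\<lambda>n. n) M0)) = 32 * k0"
    using DSOME_theta_mod_32[of n] unfolding M0_def \<sigma>_def by blast
  obtain k1 where k1: "4 * DSOME (25 * n + 1) + (qf_sum lin_weight M1 - 2 * sq_sum (\<lambda>n. n) M1 + 9 * qf_sum chi_weight M1
      - 2 * sq_sum chi M1 + 6 * qf_sum pos_weight M1 - 12 * (- \<sigma> * sq_sum (\<lambda>n. n) M1)) = 32 * k1"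
    using DSOME_theta_mod_32[of "25 * n + 1"] unfolding M s \<sigma>_def by blast
  obtain k2 where k2: "4 * DSOME (625 * n + 26) + (qf_sum lin_weight M2 - 2 * sq_sum (\<lambda>n. n) M2 + 9 * qf_sum chi_weight M2
      - 2 * sq_sum chi M2 + 6 * qf_sum pos_weight M2 - 12 * (\<sigma> * sq_sum (\<lambda>n. n) M2)) = 32 * k2"
    using DSOME_theta_mod_32[of "625 * n + 26"] unfolding M s \<sigma>_def by blast
  obtain k3 where k3: "4 * DSOME (15625 * n + 651) + (qf_sum lin_weight M3 - 2 * sq_sum (\<lambda>n. n) M3 + 9 * qf_sum chi_weight M3
      - 2 * sq_sum chi M3 + 6 * qf_sum pos_weight M3 - 12 * (- \<sigma> * sq_sum (\<lambda>n. n) M3)) = 32 * k3"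
    using DSOME_theta_mod_32[of "15625 * n + 651"] unfolding M s \<sigma>_def by blast
  obtain a0 b0 h where m0: "qf_sum lin_weight M0 = qf_sum chi_weight M0 + 4 * a0" "qf_sum pos_weight M0 = qf_sum chi_weight M0 + 4 * b0"
    "sq_sum (\<lambda>n. n) M0 = sq_sum chi M0 + 2 * h"
    using theta_coeffs_mod[of n] unfolding M0_def by blast
  obtain a1 b1 where m1: "qf_sum lin_weight M1 = qf_sum chi_weight M1 + 4 * a1" "qf_sum pos_weight M1 = qf_sum chi_weight M1 + 4 * b1"
    using theta_coeffs_mod(1,2)[of "25 * n + 1"] unfolding M by blast
  have g: "sq_sum chi (25 * K) = - 1 * sq_sum chi K" for K
    by (rule sq_sum_hecke) (unfold mult_minus1, rule chi_shift)
  have t: "sq_sum (\<lambda>n. n) (25 * K) = - 5 * sq_sum (\<lambda>n. n) K" for K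
    by (rule sq_sum_hecke) (rule refl)
  show "[DSOME (15625 * n + 651) = 5 * DSOME (25 * n + 1) + DSOME (625 * n + 26) - 5 * DSOME n] (mod 8)"
  proof (rule eigenform_combination[OF k0 k1 k2 k3 _ _ _ _ _ _ _ _ _ _ _ _ _ _ _ m0(1) m1(1) m0(2) m1(2) m0(3)])
    show "qf_sum lin_weight M2 = - 2 * qf_sum lin_weight M1 - 25 * qf_sum lin_weight M0"
      "qf_sum lin_weight M3 = - 2 * qf_sum lin_weight M2 - 25 * qf_sum lin_weight M1"
      using hecke_lin_weight[of M1] hecke_lin_weight[of M2] dvd by (simp_all add: M2_def[symmetric] M3_def[symmetric])
    show "qf_sum pos_weight M2 = 2 * qf_sum pos_weight M1 - 25 * qf_sum pos_weight M0"
      "qf_sum pos_weight M3 = 2 * qf_sum pos_weight M2 - 25 * qf_sum pos_weight M1"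
      using hecke_pos_weight[of M1] hecke_pos_weight[of M2] dvd by (simp_all add: M2_def[symmetric] M3_def[symmetric])
    show "qf_sum chi_weight M2 = - 2 * qf_sum chi_weight M1 - qf_sum chi_weight M0"
      "qf_sum chi_weight M3 = - 2 * qf_sum chi_weight M2 - qf_sum chi_weight M1"
      using hecke_chi_weight[of M1] hecke_chi_weight[of M2] dvd by (simp_all add: M2_def[symmetric] M3_def[symmetric])
    show "sq_sum chi M1 = - sq_sum chi M0" "sq_sum chi M2 = - sq_sum chi M1" "sq_sum chi M3 = - sq_sum chi M2"
      unfolding M1_def M2_def M3_def g by simp_all
    show T: "sq_sum (\<lambda>n. n) M1 = - 5 * sq_sum (\<lambda>n. n) M0" "sq_sum (\<lambda>n. n) M2 = - 5 * sq_sum (\<lambda>n. n) M1"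
      "sq_sum (\<lambda>n. n) M3 = - 5 * sq_sum (\<lambda>n. n) M2"
      unfolding M1_def M2_def M3_def by (rule t)+
    show "- \<sigma> * sq_sum (\<lambda>n. n) M1 = 5 * (\<sigma> * sq_sum (\<lambda>n. n) M0)"
      "\<sigma> * sq_sum (\<lambda>n. n) M2 = 5 * (- \<sigma> * sq_sum (\<lambda>n. n) M1)"
      "- \<sigma> * sq_sum (\<lambda>n. n) M3 = 5 * (\<sigma> * sq_sum (\<lambda>n. n) M2)"
      unfolding T by simp_all
  qed
next
  fix n r :: nat
  assume r: "1 \<le> r \<and> r \<le> 4"
  define M1 M2 M3 where "M1 = 5 * (120 * int n + 24 * int r + 5)" and "M2 = 25 * M1" and "M3 = 25 * M2"
  have M: "24 * int (25 * n + 5 * r + 1) + 1 = M1" "24 * int (625 * n + 125 * r + 26) + 1 = M2"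
    "24 * int (15625 * n + 3125 * r + 651) + 1 = M3"
    by (simp_all add: M1_def M2_def M3_def)
  \<comment> \<open>With 1 <= r <= 4 the factor 5 occurs exactly once in \<open>M1\<close>. The
    second-order recurrences then have no predecessor term, and the unary sums vanish since
    \<open>M1\<close> is no square.\<close>
  have "\<not> 5 dvd 120 * int n + 24 * int r + 5" using r by presburger
  then have "\<not> 25 dvd M1" unfolding M1_def by presburger
  then have dvd: "5 dvd M1" "\<not> 25 dvd M1" "5 dvd M2" "25 dvd M2" "M2 div 25 = M1"
    by (simp_all add: M1_def M2_def)
  have sq0: "sq_sum w M1 = 0" for w by (rule sq_sum_eq_0[OF dvd(1,2)])
  have g: "sq_sum chi (25 * K) = - 1 * sq_sum chi K" for K
    by (rule sq_sum_hecke) (unfold mult_minus1, rule chi_shift)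
  have t: "sq_sum (\<lambda>n. n) (25 * K) = - 5 * sq_sum (\<lambda>n. n) K" for K
    by (rule sq_sum_hecke) (rule refl)
  have sq: "sq_sum chi M1 = 0" "sq_sum chi M2 = 0" "sq_sum chi M3 = 0"
    "sq_sum (\<lambda>n. n) M1 = 0" "sq_sum (\<lambda>n. n) M2 = 0" "sq_sum (\<lambda>n. n) M3 = 0"
    unfolding M3_def M2_def g t sq0 by simp_all
  obtain k1 where k1: "4 * DSOME (25 * n + 5 * r + 1) + (qf_sum lin_weight M1 - 2 * 0 + 9 * qf_sum chi_weight M1
      - 2 * 0 + 6 * qf_sum pos_weight M1 - 12 * 0) = 32 * k1"
    using DSOME_theta_mod_32[of "25 * n + 5 * r + 1"] unfolding M sq mult_zero_right by blast
  obtain k2 where k2: "4 * DSOME (625 * n + 125 * r + 26) + (qf_sum lin_weight M2 - 2 * 0 + 9 * qf_sum chi_weight M2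
      - 2 * 0 + 6 * qf_sum pos_weight M2 - 12 * 0) = 32 * k2"
    using DSOME_theta_mod_32[of "625 * n + 125 * r + 26"] unfolding M sq mult_zero_right by blast
  obtain k3 where k3: "4 * DSOME (15625 * n + 3125 * r + 651) + (qf_sum lin_weight M3 - 2 * 0 + 9 * qf_sum chi_weight M3
      - 2 * 0 + 6 * qf_sum pos_weight M3 - 12 * 0) = 32 * k3"
    using DSOME_theta_mod_32[of "15625 * n + 3125 * r + 651"] unfolding M sq mult_zero_right by blast
  obtain a1 b1 where m1: "qf_sum lin_weight M1 = qf_sum chi_weight M1 + 4 * a1" "qf_sum pos_weight M1 = qf_sum chi_weight M1 + 4 * b1"
    using theta_coeffs_mod(1,2)[of "25 * n + 5 * r + 1"] unfolding M by blast
  have "[DSOME (15625 * n + 3125 * r + 651) =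
      5 * DSOME (25 * n + 5 * r + 1) + DSOME (625 * n + 125 * r + 26) - 5 * 0] (mod 8)"
  \<comment> \<open>The missing predecessor enters as a level on which every quantity, including
    \<open>D0\<close>, is 0.\<close>
  proof (rule eigenform_combination[OF _ k1 k2 k3 _ _ _ _ _ _ _ _ _ _ _ _ _ _ _ _ m1(1) _ m1(2)])
    show "4 * 0 + (0 - 2 * 0 + 9 * 0 - 2 * 0 + 6 * 0 - 12 * 0) = 32 * (0::int)" by simp
    show "qf_sum lin_weight M2 = - 2 * qf_sum lin_weight M1 - 25 * 0" "qf_sum lin_weight M3 = - 2 * qf_sum lin_weight M2 - 25 * qf_sum lin_weight M1"
      using hecke_lin_weight[of M1] hecke_lin_weight[of M2] dvd by (simp_all add: M2_def[symmetric] M3_def[symmetric])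
    show "qf_sum pos_weight M2 = 2 * qf_sum pos_weight M1 - 25 * 0" "qf_sum pos_weight M3 = 2 * qf_sum pos_weight M2 - 25 * qf_sum pos_weight M1"
      using hecke_pos_weight[of M1] hecke_pos_weight[of M2] dvd by (simp_all add: M2_def[symmetric] M3_def[symmetric])
    show "qf_sum chi_weight M2 = - 2 * qf_sum chi_weight M1 - 0" "qf_sum chi_weight M3 = - 2 * qf_sum chi_weight M2 - qf_sum chi_weight M1"
      using hecke_chi_weight[of M1] hecke_chi_weight[of M2] dvd by (simp_all add: M2_def[symmetric] M3_def[symmetric])
  qed simp_all
  then show "[DSOME (15625 * n + 3125 * r + 651) =
      5 * DSOME (25 * n + 5 * r + 1) + DSOME (625 * n + 125 * r + 26)] (mod 8)" by simp
qed

end
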